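(* Consider the four-class linear classification problem described in the context, with parameters $\gamma\ge0$ and $1/4<\theta<1$, and the generalized hinge loss $V$ given there. Let $\hat{\boldsymbol f}$ be a minimizer over $\boldsymbol f\in\mathcal F$ of $n^{-1}\sum_{i=1}^nV(\boldsymbol f,Z_i)+\lambda J(\boldsymbol f)$ with $\lambda\sim n^{-1}$. Then $$e(\hat{\boldsymbol f},\bar{\boldsymbol f})=e(\hat{\boldsymbol f},\boldsymbol f^V)=|e(\hat{\boldsymbol f},\boldsymbol f^V)|=O_p\big(n^{-(\gamma+1)/2}\big)\quad\text{and}\quad E|e(\hat{\boldsymbol f},\boldsymbol f^V)|=O\big(n^{-(\gamma+1)/2}\big).$$
   Context: $\boldsymbol X=(X_1,X_2)$ has probability density $q(x_1,x_2)=\kappa\min(|x_1|,|x_2|)^\gamma$ on $[-1,1]^2$, with $\gamma\ge0$ and normalizing constant $\kappa>0$. Let $S_1=\{x_1\ge0,x_2\ge0\}$, $S_2=\{x_1\ge0,x_2<0\}$, $S_3=\{x_1<0,x_2\ge0\}$, $S_4=\{x_1<0,x_2<0\}$. Given $\boldsymbol X=\boldsymbol x\in S_j$, $Y=j$ with probability $\theta$ and $Y$ equals each of the other three classes in $\{1,2,3,4\}$ with probability $(1-\theta)/3$, where $1/4<\theta<1$. $Z_i=(\boldsymbol X_i,Y_i)$, $i=1,\dots,n$, are i.i.d. copies of $Z=(\boldsymbol X,Y)$. $\mathcal F$ is the set of $\boldsymbol f=(f_1,\dots,f_4)$ with $f_c(\boldsymbol x)=\boldsymbol w_c^T\boldsymbol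 x$, $\boldsymbol w_c=(w_{c1},w_{c2})\in\mathbb R^2$, and $\boldsymbol w_4=-(\boldsymbol w_1+\boldsymbol w_2+\boldsymbol w_3)$. The penalty is $J(\boldsymbol f)=\sum_{c=1}^4\sum_{j=1}^2w_{cj}^2$. The loss is $V(\boldsymbol f,z)=h(\boldsymbol u(\boldsymbol f(\boldsymbol x),y))$ for $z=(\boldsymbol x,y)$, where $k=4$, $\boldsymbol u(\boldsymbol f(\boldsymbol x),y)=(u_1,\dots,u_{k-1})$ lists the differences $f_y(\boldsymbol x)-f_j(\boldsymbol x)$, $j\ne y$, and $h(\boldsymbol u)=\sum_{j=1}^{k-1}\big[\frac{\sum_{c=1}^{k-1}u_c}{k}-u_j+1\big]_+$, with $[x]_+=\max(x,0)$. $\boldsymbol f^V$ is the minimizer of $EV(\boldsymbol f,Z)$ over $\mathcal F$. $L(\boldsymbol f,z)=I(y\ne\arg\max_jf_j(\boldsymbol x))$; $\bar{\boldsymbol f}$ is a (global) Bayes rule, i.e. a minimizer of $EL(\boldsymbol f,Z)$ over all measurable $\boldsymbol f$; $e(\boldsymbol f,\boldsymbol g)=EL(\boldsymbol f,Z)-EL(\boldsymbol g,Z)$, evaluated at the random $\hat{\boldsymbol f}$ where applicable. $\lambda\sim n^{-1}$ means $\lambda=\lambda_n$ is of exact order $n^{-1}$. *)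

theory Defs
  imports "HOL-Probability.Probability" "HOL-Library.Landau_Symbols"
begin

text \<open>
  The class labels 1, 2, 3, 4 are the elements of the four-element type \<^typ>\<open>4\<close>
  (arithmetic there is modulo 4, so the label 4 is also the element 0; no arithmetic
  on labels is used).  A decision function vector \<open>(f\<^sub>1, \<dots>, f\<^sub>4)\<close> is a map into
  \<^typ>\<open>real^4\<close>.
\<close>

definition square :: "(real^2) set" where
  "square = {x. \<forall>i. \<bar>x $ i\<bar> \<le> 1}"

text \<open>
  For \<open>\<gamma> = 0\<close> the convention \<open>0 powr 0 = 0\<close> changes the density on the coordinate axes only,
  which are null sets.
\<close>

definition shape :: "real \<Rightarrow> real^2 \<Rightarrow> real" where
  "shape \<gamma> x = min \<bar>x $ 1\<bar> \<bar>x $ 2\<bar> powr \<gamma> * indicator square x"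

definition kappa :: "real \<Rightarrow> real" where
  "kappa \<gamma> = 1 / (\<integral>x. shape \<gamma> x \<partial>lborel)"

definition q_density :: "real \<Rightarrow> real^2 \<Rightarrow> real" where
  "q_density \<gamma> x = kappa \<gamma> * shape \<gamma> x"

definition S_region :: "4 \<Rightarrow> (real^2) set" where
  "S_region j = (if j = 1 then {x. x $ 1 \<ge> 0 \<and> x $ 2 \<ge> 0}
     else if j = 2 then {x. x $ 1 \<ge> 0 \<and> x $ 2 < 0}
     else if j = 3 then {x. x $ 1 < 0 \<and> x $ 2 \<ge> 0}
     else {x. x $ 1 < 0 \<and> x $ 2 < 0})"

definition cond_prob_label :: "real \<Rightarrow> real^2 \<Rightarrow> 4 \<Rightarrow> real" where
  "cond_prob_label \<theta> x y = (if x \<in> S_region y then \<theta> else (1 - \<theta>) / 3)"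

text \<open>
  Joint law: \<open>P(X \<in> A, Y = y)\<close> is the integral over \<open>A\<close> of \<open>q_density(x) P(Y = y | X = x)\<close>.
\<close>

definition law :: "real \<Rightarrow> real \<Rightarrow> ((real^2) \<times> 4) measure" where
  "law \<gamma> \<theta> = density (lborel \<Otimes>\<^sub>M count_space UNIV)
     (\<lambda>(x, y). ennreal (q_density \<gamma> x * cond_prob_label \<theta> x y))"

definition lin :: "real^2^4 \<Rightarrow> real^2 \<Rightarrow> real^4" where
  "lin w x = (\<chi> c. w $ c \<bullet> x)"

text \<open>The class of functions \<open>\<F>\<close> is \<open>lin ` weights\<close>; \<open>lin\<close> is injective.\<close>

definition weights :: "(real^2^4) set" where
  "weights = {w. w $ 4 = - (w $ 1 + w $ 2 + w $ 3)}"

definition penalty :: "real^2^4 \<Rightarrow> real" where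
  "penalty w = (\<Sum>c\<in>UNIV. \<Sum>j\<in>UNIV. (w $ c $ j)\<^sup>2)"

definition margins :: "real^4 \<Rightarrow> 4 \<Rightarrow> real list" where
  "margins v y = map (\<lambda>j. v $ y - v $ j) (filter (\<lambda>j. j \<noteq> y) [1, 2, 3, 4])"

definition h_loss :: "real list \<Rightarrow> real" where
  "h_loss us = (\<Sum>t\<leftarrow>us. max (sum_list us / 4 - t + 1) 0)"

definition V_loss :: "(real^2 \<Rightarrow> real^4) \<Rightarrow> (real^2) \<times> 4 \<Rightarrow> real" where
  "V_loss f = (\<lambda>(x, y). h_loss (margins (f x) y))"

text \<open>
  Ties in the argmax are broken by the unspecified rule inherent in \<^const>\<open>arg_max\<close>; the selected
  label depends only on the set of maximizing labels.  Counting every maximizing label as correct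
  is not an option: constant decision functions would then have loss zero.
\<close>

definition L_loss :: "(real^2 \<Rightarrow> real^4) \<Rightarrow> (real^2) \<times> 4 \<Rightarrow> real" where
  "L_loss f = (\<lambda>(x, y). if y \<noteq> (ARG_MAX (\<lambda>j. f x $ j) j. True) then 1 else 0)"

definition EV :: "real \<Rightarrow> real \<Rightarrow> (real^2 \<Rightarrow> real^4) \<Rightarrow> real" where
  "EV \<gamma> \<theta> f = (\<integral>z. V_loss f z \<partial>law \<gamma> \<theta>)"

definition EL :: "real \<Rightarrow> real \<Rightarrow> (real^2 \<Rightarrow> real^4) \<Rightarrow> real" where
  "EL \<gamma> \<theta> f = (\<integral>z. L_loss f z \<partial>law \<gamma> \<theta>)"

definition excess :: "real \<Rightarrow> real \<Rightarrow> (real^2 \<Rightarrow> real^4) \<Rightarrow> (real^2 \<Rightarrow> real^4) \<Rightarrow> real" where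
  "excess \<gamma> \<theta> f g = EL \<gamma> \<theta> f - EL \<gamma> \<theta> g"

definition bayes_rule :: "real \<Rightarrow> real \<Rightarrow> (real^2 \<Rightarrow> real^4) \<Rightarrow> bool" where
  "bayes_rule \<gamma> \<theta> f \<longleftrightarrow> is_arg_min (EL \<gamma> \<theta>) (\<lambda>g. g \<in> borel_measurable borel) f"

definition objective :: "(nat \<Rightarrow> (real^2) \<times> 4) \<Rightarrow> nat \<Rightarrow> real \<Rightarrow> real^2^4 \<Rightarrow> real" where
  "objective z n l w = (\<Sum>i=1..n. V_loss (lin w) (z i)) / real n + l * penalty w"

definition O_p :: "'a measure \<Rightarrow> (nat \<Rightarrow> 'a \<Rightarrow> real) \<Rightarrow> (nat \<Rightarrow> real) \<Rightarrow> bool" where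
  "O_p M X a \<longleftrightarrow> (\<forall>\<epsilon>>0. \<exists>C>0. \<forall>\<^sub>F n in sequentially.
     measure M {\<omega> \<in> space M. \<bar>X n \<omega>\<bar> > C * a n} < \<epsilon>)"

end

theory Submission
  imports Defs "HOL-Real_Asymp.Real_Asymp"
begin

text \<open>
  On \<open>weights\<close> the scores add up to zero, so the differences \<open>f\<^sub>y - f\<^sub>j\<close> add up to \<open>4 f\<^sub>y\<close> and the loss
  collapses to \<open>\<Sum>\<^bsub>j \<noteq> y\<^esub> max (w\<^sub>j \<bullet> x + 1) 0\<close> (\<open>V_loss_lin\<close>). Its expectation
  decouples into a sum over the four classes of convex functions of one row \<open>w\<^sub>j\<close> each (\<open>hinge_risk\<close>,
  \<open>label_hinge_risk\<close>), and reflections of the square carry the function of class \<open>j\<close> to that of class 1 (\<open>hinge_risk_flip\<close>).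

  The function of class 1 is invariant under exchange of the coordinates, so by convexity it has a minimizer
  \<open>(s, s)\<close> on the diagonal. On \<open>\<bar>s\<bar> \<le> 1/2\<close> the positive part is inactive in the whole square and the
  function is affine with negative slope, because \<open>\<theta> > 1/4\<close>; therefore \<open>s > 1/2\<close>
  (\<open>hinge_risk_minimizer\<close>). Then the line \<open>s (x\<^sub>1 + x\<^sub>2) = -1\<close>, on which the positive part has its kink,
  crosses the interior of the square. The mass of \<open>X\<close> near this line gives quadratic growth of the
  risk around \<open>(s, s)\<close>, from below and from above (\<open>kink_integral_lower\<close>, \<open>kink_integral_upper\<close>,
  \<open>quadratic_growth\<close>). In particular the minimizer \<open>w\<^sub>V\<close> is unique: its rows are \<open>s\<close> times the four
  corners of the square, so off the axes the decision of \<open>w\<^sub>V\<close> is the quadrant of \<open>x\<close> and \<open>w\<^sub>V\<close> attains the Bayes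
  risk \<open>1 - \<theta>\<close>. This gives the equalities in the theorem.

  If \<open>w\<close> is at distance \<open>d\<close> from \<open>w\<^sub>V\<close>, its decision can be wrong only where
  \<open>min (\<bar>x\<^sub>1\<bar>, \<bar>x\<^sub>2\<bar>) \<le> 4 d\<close>, a neighbourhood of the axes of area of order \<open>d\<close> in which the density is at
  most of order \<open>d\<^sup>\<gamma>\<close>; hence the excess risk is at most of order \<open>d\<^bsup>\<gamma> + 1\<^esup>\<close> (\<open>EL_near_pattern\<close>).

  It remains to see that the distance of the estimator to \<open>w\<^sub>V\<close> is of order \<open>n\<^bsup>-1/2\<^esup>\<close> with Gaussian
  tails (\<open>penalized_minimizer_tail\<close>). A union bound over a net of a sphere of radius \<open>r\<close> which is fine
  enough to exploit Lipschitz continuity alone would cost a logarithmic factor. Convexity of the loss avoids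
  this: to bound a convex function from below on a sphere it is enough to know it at a finite set of
  points whose number does not depend on \<open>r\<close> or \<open>n\<close>
  (\<open>convex_lower_bound_from_test_points\<close>), and Hoeffding's inequality at each of these points suffices.
  Splitting the range of the distance into shells of width \<open>n\<^bsup>-1/2\<^esup>\<close> then turns the tails into both rates
  (\<open>rate_from_tail\<close>).
\<close>

section \<open>Tails of penalized minimizers of convex losses\<close>

text \<open>
  The test points are a net \<open>T\<close> of the unit sphere and the vertices \<open>S\<close> of a cube around the ball of
  radius 2. The vertices bound \<open>\<phi>\<close> from above on that ball. A point \<open>e\<close> of the sphere lies on a line
  with a point \<open>u\<close> of the net next to it and a point \<open>v\<close> of the ball beyond \<open>u\<close>; convexity and
  the upper bound at \<open>v\<close> prevent \<open>\<phi> e\<close> from being much smaller than \<open>\<phi> u\<close>.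
\<close>

lemma convex_lower_bound_from_test_points:
  fixes c C :: real
  assumes "0 < c"
  obtains U :: "'e::euclidean_space set" and B :: real where
    "finite U" "0 < B" "U \<subseteq> cball 0 B"
    "\<And>\<phi> \<psi> e. \<lbrakk>convex_on UNIV \<phi>;
        \<And>u. norm u \<le> B \<Longrightarrow> c * (norm u)\<^sup>2 \<le> \<psi> u \<and> \<psi> u \<le> C * (norm u)\<^sup>2;
        \<And>u. u \<in> U \<Longrightarrow> \<bar>\<phi> u - \<psi> u\<bar> \<le> c / 4; norm e = 1\<rbrakk> \<Longrightarrow> c / 2 \<le> \<phi> e"
proof -
  obtain S :: "'e set" where S: "finite S"
    "cbox (0 - (\<Sum>i\<in>Basis. 2 *\<^sub>R i)) (0 + (\<Sum>i\<in>Basis. 2 *\<^sub>R i)) = convex hull S"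
    using cube_convex_hull[of 2 "0::'e"] by (metis zero_less_numeral)
  have hull: "v \<in> convex hull S" if "norm v \<le> 2" for v
  proof -
    have "\<bar>v \<bullet> i\<bar> \<le> 2" if "i \<in> Basis" for i
      using Basis_le_norm[OF that, of v] \<open>norm v \<le> 2\<close> by linarith
    then show ?thesis
      unfolding S(2)[symmetric]
      by (fastforce simp: mem_box inner_sum_left_Basis abs_le_iff)
  qed
  obtain B where B: "1 \<le> B" "\<And>u. u \<in> S \<Longrightarrow> norm u \<le> B"
  proof
    show "1 \<le> Max (insert 1 (norm ` S))" using S(1) by simp
    show "norm u \<le> Max (insert 1 (norm ` S))" if "u \<in> S" for u using S(1) that by simp
  qed
  define K where "K = \<bar>C\<bar> * B\<^sup>2 + c"
  have K: "c \<le> K" "0 < K" using \<open>0 < c\<close> by (auto simp: K_def add_nonneg_pos)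
  \<comment> \<open>The extrapolated point costs at most \<open>\<delta> * K\<close>, which this choice makes equal to \<open>c / 4\<close>.\<close>
  define \<delta> where "\<delta> = c / (4 * K)"
  have \<delta>: "0 < \<delta>" "\<delta> < 1" "\<delta> * K = c / 4"
    using K \<open>0 < c\<close> by (auto simp: \<delta>_def field_simps)
  have "sphere 0 1 \<subseteq> (\<Union>x\<in>sphere (0::'e) 1. ball x \<delta>)" using \<delta> by auto
  then obtain T where T: "T \<subseteq> sphere (0::'e) 1" "finite T" "sphere 0 1 \<subseteq> (\<Union>x\<in>T. ball x \<delta>)"
    by (rule compactE_image[OF compact_sphere, rotated]) auto
  show thesis
  proof (rule that[of "T \<union> S" B])
    show "finite (T \<union> S)" using T S by simp
    show "0 < B" using B by simp
    show "T \<union> S \<subseteq> cball 0 B" using B T by fastforce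
    fix \<phi> \<psi> :: "'e \<Rightarrow> real" and e :: 'e
    assume cvx: "convex_on UNIV \<phi>"
      and \<psi>: "\<And>u. norm u \<le> B \<Longrightarrow> c * (norm u)\<^sup>2 \<le> \<psi> u \<and> \<psi> u \<le> C * (norm u)\<^sup>2"
      and close: "\<And>u. u \<in> T \<union> S \<Longrightarrow> \<bar>\<phi> u - \<psi> u\<bar> \<le> c / 4" and e: "norm e = 1"
    have "\<phi> u \<le> K" if "u \<in> S" for u
    proof -
      have "(norm u)\<^sup>2 \<le> B\<^sup>2" using B(2)[OF that] by (simp add: power_mono)
      then have "C * (norm u)\<^sup>2 \<le> \<bar>C\<bar> * B\<^sup>2" by (intro mult_mono) auto
      then show ?thesis
        using close[of u] \<psi>[OF B(2)[OF that]] that \<open>0 < c\<close> unfolding K_def abs_le_iff by simp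
    qed
    then have up: "\<phi> v \<le> K" if "norm v \<le> 2" for v
      using convex_on_convex_hull_bound[of S \<phi> K] convex_on_subset[OF cvx] hull[OF that] by blast
    obtain u where u: "u \<in> T" "dist u e < \<delta>" using T(3) e by (force simp: sphere_def)
    have nu: "norm u = 1" using T(1) u by auto
    have "3/4 * c \<le> \<phi> u"
      using close[of u, unfolded abs_le_iff] \<psi>[of u] u nu B by simp
    define v where "v = e + (1/\<delta>) *\<^sub>R (u - e)"
    have "norm v \<le> norm e + norm ((1/\<delta>) *\<^sub>R (u - e))" unfolding v_def by (rule norm_triangle_ineq)
    also have "norm ((1/\<delta>) *\<^sub>R (u - e)) \<le> 1"
      unfolding norm_scaleR using u(2) \<delta> by (simp add: dist_norm field_simps)
    finally have v: "norm v \<le> 2" using e by simp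
    have "u = (1 - \<delta>) *\<^sub>R e + \<delta> *\<^sub>R v" using \<delta> by (simp add: v_def algebra_simps)
    then have "\<phi> u \<le> (1 - \<delta>) * \<phi> e + \<delta> * \<phi> v"
      using convex_onD[OF cvx, of \<delta> e v] \<delta> by simp
    also have "\<dots> \<le> (1 - \<delta>) * \<phi> e + \<delta> * K" using up[OF v] \<delta> by (simp add: mult_left_mono)
    finally have *: "c / 2 \<le> (1 - \<delta>) * \<phi> e" using \<open>3/4 * c \<le> \<phi> u\<close> \<delta> by simp
    then have "0 \<le> \<phi> e" using \<open>0 < c\<close> \<delta>
      by (smt (verit) mult_nonneg_nonpos divide_pos_pos)
    then have "0 \<le> \<delta> * \<phi> e" using \<delta> by simp
    then show "c / 2 \<le> \<phi> e" using * by (simp add: left_diff_distrib)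
  qed
qed

text \<open>
  If an objective value not above that of \<open>w0\<close> occurs at distance at least \<open>r\<close> from \<open>w0\<close>, then by convexity it also
  occurs at distance exactly \<open>r\<close>. There the empirical loss increment, rescaled by \<open>r\<^sup>2\<close>, is a convex function
  which outside of finitely many Hoeffding events is close to its expectation at all test points, and
  hence exceeds \<open>c / 2\<close>. The penalty can gain only \<open>O(r / n)\<close>, which is too little
  once \<open>n\<close> is large, as \<open>r \<ge> n\<^bsup>-1/2\<^esup>\<close>. The increments are bounded by a multiple of \<open>r\<close> and have to deviate by a
  multiple of \<open>r\<^sup>2\<close>, whence the exponent \<open>n r\<^sup>2\<close>. The existential premise on \<open>A\<close> makes the bound independent of a
  measurable selection of minimizers.
\<close>

lemma (in prob_space) penalized_minimizer_tail:
  fixes Z :: "nat \<Rightarrow> 'a \<Rightarrow> 'z" and loss :: "'e::euclidean_space \<Rightarrow> 'z \<Rightarrow> real" and w0 :: 'e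
    and lam :: "nat \<Rightarrow> real" and L R c C \<Lambda> :: real
  assumes indep: "indep_vars (\<lambda>_. N) Z {1..}"
    and distr: "\<And>i. i \<ge> 1 \<Longrightarrow> distr M N (Z i) = P"
    and meas: "\<And>w. loss w \<in> borel_measurable N"
    and convex: "\<And>z. convex_on UNIV (\<lambda>w. loss w z)"
    and lip: "\<And>w. AE z in P. \<bar>loss w z - loss w0 z\<bar> \<le> L * norm (w - w0)"
    and "0 < L" "0 < R" "0 < c"
    and growth: "\<And>w. norm (w - w0) \<le> R \<Longrightarrow>
      c * (norm (w - w0))\<^sup>2 \<le> (\<integral>z. loss w z - loss w0 z \<partial>P) \<and>
      (\<integral>z. loss w z - loss w0 z \<partial>P) \<le> C * (norm (w - w0))\<^sup>2"
    and lam: "\<And>n. n \<ge> n0 \<Longrightarrow> 0 \<le> lam n \<and> lam n \<le> \<Lambda> / real n"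
  obtains K a r0 :: real and n1 :: nat where "0 \<le> K" "0 < a" "0 < r0" "1 \<le> n1"
    "\<And>n r A. \<lbrakk>n1 \<le> n; 1 / sqrt (real n) \<le> r; r \<le> r0; A \<subseteq> space M;
        \<And>\<omega>. \<omega> \<in> A \<Longrightarrow> \<exists>w. r \<le> norm (w - w0) \<and>
          (\<Sum>i=1..n. loss w (Z i \<omega>)) / real n + lam n * (norm w)\<^sup>2
            \<le> (\<Sum>i=1..n. loss w0 (Z i \<omega>)) / real n + lam n * (norm w0)\<^sup>2\<rbrakk>
      \<Longrightarrow> prob A \<le> K * exp (- a * real n * r\<^sup>2)"
proof -
  obtain U :: "'e set" and B :: real where U: "finite U" "0 < B" "U \<subseteq> cball 0 B"
    and test: "\<And>\<phi> \<psi> e. \<lbrakk>convex_on UNIV \<phi>;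
        \<And>u. norm u \<le> B \<Longrightarrow> c * (norm u)\<^sup>2 \<le> \<psi> u \<and> \<psi> u \<le> C * (norm u)\<^sup>2;
        \<And>u. u \<in> U \<Longrightarrow> \<bar>\<phi> u - \<psi> u\<bar> \<le> c / 4; norm e = 1\<rbrakk> \<Longrightarrow> c / 2 \<le> \<phi> e"
    by (rule convex_lower_bound_from_test_points[OF \<open>0 < c\<close>]) blast
  note [measurable] = meas
  have rv[measurable]: "random_variable N (Z i)" if "i \<ge> 1" for i
    using indep that unfolding indep_vars_def by auto
  \<comment> \<open>The exponent of Hoeffding's inequality for \<open>n\<close> terms in \<open>{- L * r * B..L * r * B}\<close> and the
    deviation \<open>n * r\<^sup>2 * c / 4\<close>.\<close>
  define a where "a = c\<^sup>2 / (32 * (L * B)\<^sup>2)"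
  \<comment> \<open>From \<open>n1\<close> on, the gain \<open>2 * \<Lambda> * norm w0 * r / n\<close> of the penalty is below \<open>r\<^sup>2 * c / 2\<close>
    for all \<open>r \<ge> 1 / sqrt n\<close>.\<close>
  define n1 where "n1 = Suc (max n0 (nat \<lceil>(4 * \<bar>\<Lambda>\<bar> * norm w0 / c)\<^sup>2\<rceil>))"
  show thesis
  proof (rule that[of "2 * real (card U)" a "R / B" n1])
    show "0 \<le> 2 * real (card U)" by simp
    show "0 < a" using \<open>0 < c\<close> \<open>0 < L\<close> \<open>0 < B\<close> by (simp add: a_def)
    show "0 < R / B" using \<open>0 < R\<close> \<open>0 < B\<close> by simp
    show "1 \<le> n1" by (simp add: n1_def)
    fix n r A
    assume n: "n1 \<le> n" and r1: "1 / sqrt (real n) \<le> r" and r2: "r \<le> R / B"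
      and A: "A \<subseteq> space M"
        "\<And>\<omega>. \<omega> \<in> A \<Longrightarrow> \<exists>w. r \<le> norm (w - w0) \<and>
          (\<Sum>i=1..n. loss w (Z i \<omega>)) / real n + lam n * (norm w)\<^sup>2
            \<le> (\<Sum>i=1..n. loss w0 (Z i \<omega>)) / real n + lam n * (norm w0)\<^sup>2"
    have n_pos: "0 < n" using n by (simp add: n1_def)
    have r: "0 < r" using r1 n_pos by (meson less_le_trans of_nat_0_less_iff real_sqrt_gt_0_iff zero_less_divide_1_iff)
    have lamn: "0 \<le> lam n" "lam n \<le> \<Lambda> / real n" using lam[of n] n by (auto simp: n1_def)
    define X where "X = (\<lambda>u i \<omega>. loss (w0 + r *\<^sub>R u) (Z i \<omega>) - loss w0 (Z i \<omega>))"
    define \<mu> where "\<mu> = (\<lambda>u. \<integral>z. loss (w0 + r *\<^sub>R u) z - loss w0 z \<partial>P)"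
    define bad where "bad = (\<lambda>u. {\<omega>\<in>space M. real n * r\<^sup>2 * c / 4 \<le> \<bar>(\<Sum>i=1..n. X u i \<omega>) - real n * \<mu> u\<bar>})"
    have Xmeas[measurable]: "X u i \<in> borel_measurable M" if "i \<in> {1..n}" for u i
    proof -
      have [measurable]: "random_variable N (Z i)" using that by (intro rv) auto
      show ?thesis unfolding X_def by measurable
    qed
    have bad_sets: "bad u \<in> events" for u unfolding bad_def by measurable
    have bad_prob: "prob (bad u) \<le> 2 * exp (- a * real n * r\<^sup>2)" if u: "u \<in> U" for u
    proof -
      define b where "b = L * (r * B)"
      have b: "0 < b" using \<open>0 < L\<close> r \<open>0 < B\<close> by (simp add: b_def)
      have EX: "expectation (X u i) = \<mu> u" if "1 \<le> i" for i
      proof -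
        have "expectation (X u i) = (\<integral>z. loss (w0 + r *\<^sub>R u) z - loss w0 z \<partial>distr M N (Z i))"
          unfolding X_def using rv[OF that] by (subst integral_distr) auto
        then show ?thesis using distr[OF that] by (simp add: \<mu>_def)
      qed
      interpret Hoeffding_ineq M "{1..n}" "X u" "\<lambda>_. - b" "\<lambda>_. b" "real n * \<mu> u"
      proof unfold_locales
        show "finite {1..n}" by simp
        show "indep_vars (\<lambda>_. borel) (X u) {1..n}"
          unfolding X_def
          by (rule indep_vars_compose2[OF indep_vars_subset[OF indep]]) auto
        show "AE x in M. X u i x \<in> {- b..b}" if "i \<in> {1..n}" for i
        proof -
          have i: "1 \<le> i" using that by simp
          have "AE z in distr M N (Z i). \<bar>loss (w0 + r *\<^sub>R u) z - loss w0 z\<bar> \<le> L * norm (w0 + r *\<^sub>R u - w0)"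
            unfolding distr[OF i] by (rule lip)
          then have "AE x in M. \<bar>X u i x\<bar> \<le> L * norm (w0 + r *\<^sub>R u - w0)"
            unfolding X_def using rv[OF i] by (subst (asm) AE_distr_iff) auto
          moreover have "L * norm (w0 + r *\<^sub>R u - w0) \<le> b"
            using U u r \<open>0 < L\<close> by (auto simp: b_def intro!: mult_left_mono)
          ultimately show ?thesis by (elim eventually_mono) (auto simp: abs_le_iff simp del: norm_scaleR)
        qed
        show "real n * \<mu> u \<equiv> \<Sum>i=1..n. expectation (X u i)" by (rule eq_reflection) (simp add: EX)
      qed
      have "prob (bad u) \<le> 2 * exp (- 2 * (real n * r\<^sup>2 * c / 4)\<^sup>2 / (\<Sum>i=1..n. (b - - b)\<^sup>2))"
        unfolding bad_def
        by (rule Hoeffding_ineq_abs_ge) (use \<open>0 < c\<close> b n_pos in auto)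
      also have "- 2 * (real n * r\<^sup>2 * c / 4)\<^sup>2 / (\<Sum>i=1..n. (b - - b)\<^sup>2) = - a * real n * r\<^sup>2"
        using \<open>0 < L\<close> \<open>0 < B\<close> r n_pos
        by (simp add: a_def b_def field_simps power2_eq_square)
      finally show ?thesis .
    qed
    have "A \<subseteq> (\<Union>u\<in>U. bad u)"
    proof (rule ccontr)
      assume "\<not> ?thesis"
      then obtain \<omega> where \<omega>: "\<omega> \<in> A" "\<And>u. u \<in> U \<Longrightarrow> \<omega> \<notin> bad u" by blast
      obtain w where w: "r \<le> norm (w - w0)"
        and obj: "(\<Sum>i=1..n. loss w (Z i \<omega>)) / real n + lam n * (norm w)\<^sup>2
            \<le> (\<Sum>i=1..n. loss w0 (Z i \<omega>)) / real n + lam n * (norm w0)\<^sup>2"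
        using A(2)[OF \<omega>(1)] by blast
      define \<phi> where "\<phi> = (\<lambda>u. (\<Sum>i=1..n. X u i \<omega>) / (real n * r\<^sup>2))"
      define e where "e = (1 / norm (w - w0)) *\<^sub>R (w - w0)"
      have e: "norm e = 1" using w r by (auto simp: e_def)
      have cvx_term: "convex_on UNIV (\<lambda>u. X u i \<omega>)" for i
      proof (rule convex_onI)
        fix t :: real and x y :: 'e assume t: "0 < t" "t < 1"
        have eq: "w0 + r *\<^sub>R ((1 - t) *\<^sub>R x + t *\<^sub>R y) = (1 - t) *\<^sub>R (w0 + r *\<^sub>R x) + t *\<^sub>R (w0 + r *\<^sub>R y)"
          by (simp add: algebra_simps)
        show "X ((1 - t) *\<^sub>R x + t *\<^sub>R y) i \<omega> \<le> (1 - t) * X x i \<omega> + t * X y i \<omega>"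
          using convex_onD[OF convex, of t "w0 + r *\<^sub>R x" "w0 + r *\<^sub>R y" "Z i \<omega>"] t
          unfolding X_def eq by (simp add: algebra_simps)
      qed simp
      have cvx: "convex_on UNIV \<phi>"
      proof -
        have "convex_on UNIV (\<lambda>u. (1 / (real n * r\<^sup>2)) * (\<Sum>i=1..n. X u i \<omega>))"
        proof (rule convex_on_cmul)
          have "convex_on UNIV (\<lambda>u. \<Sum>i\<in>I. X u i \<omega>)" if "finite I" for I
            using that by induction (auto intro!: convex_on_add cvx_term simp: convex_on_const)
          then show "convex_on UNIV (\<lambda>u. \<Sum>i=1..n. X u i \<omega>)" by simp
        qed simp
        then show ?thesis by (simp add: \<phi>_def)
      qed
      have "c / 2 \<le> \<phi> e"
      proof (rule test[OF cvx _ _ e])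
        fix u :: 'e assume u: "norm u \<le> B"
        have "norm (w0 + r *\<^sub>R u - w0) \<le> R"
        proof -
          have "r * norm u \<le> (R / B) * B" using r2 u r \<open>0 < R\<close> \<open>0 < B\<close> by (intro mult_mono) auto
          then show ?thesis using r \<open>0 < B\<close> by simp
        qed
        then have "c * (norm (r *\<^sub>R u))\<^sup>2 \<le> \<mu> u \<and> \<mu> u \<le> C * (norm (r *\<^sub>R u))\<^sup>2"
          using growth[of "w0 + r *\<^sub>R u"] by (simp add: \<mu>_def)
        then show "c * (norm u)\<^sup>2 \<le> \<mu> u / r\<^sup>2 \<and> \<mu> u / r\<^sup>2 \<le> C * (norm u)\<^sup>2"
          using r by (simp add: field_simps)
      next
        fix u assume "u \<in> U"
        then have lt: "\<bar>(\<Sum>i=1..n. X u i \<omega>) - real n * \<mu> u\<bar> < real n * r\<^sup>2 * c / 4"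
          using \<omega>(2)[of u] \<omega>(1) A(1) unfolding bad_def mem_Collect_eq by (meson not_le subsetD)
        have "\<phi> u - \<mu> u / r\<^sup>2 = ((\<Sum>i=1..n. X u i \<omega>) - real n * \<mu> u) / (real n * r\<^sup>2)"
          using n_pos r by (simp add: \<phi>_def field_simps)
        then have "\<bar>\<phi> u - \<mu> u / r\<^sup>2\<bar> = \<bar>(\<Sum>i=1..n. X u i \<omega>) - real n * \<mu> u\<bar> / (real n * r\<^sup>2)"
          using r by (simp add: abs_mult)
        also have "\<dots> \<le> (real n * r\<^sup>2 * c / 4) / (real n * r\<^sup>2)"
          by (rule divide_right_mono) (use lt in auto)
        also have "\<dots> = c / 4" using n_pos r by simp
        finally show "\<bar>\<phi> u - \<mu> u / r\<^sup>2\<bar> \<le> c / 4" .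
      qed
      then have low: "real n * r\<^sup>2 * c / 2 \<le> (\<Sum>i=1..n. X e i \<omega>)"
        using n_pos r by (simp add: \<phi>_def field_simps)
      \<comment> \<open>Move \<open>w\<close> towards \<open>w0\<close> until the distance is exactly \<open>r\<close>.\<close>
      define t where "t = r / norm (w - w0)"
      have t: "0 < t" "t \<le> 1" using w r by (auto simp: t_def divide_simps)
      define v where "v = w0 + r *\<^sub>R e"
      have v: "v = (1 - t) *\<^sub>R w0 + t *\<^sub>R w"
        by (simp add: v_def e_def t_def algebra_simps)
      define F where "F = (\<lambda>w. (\<Sum>i=1..n. loss w (Z i \<omega>)) / real n + lam n * (norm w)\<^sup>2)"
      have sum_v: "(\<Sum>i=1..n. loss v (Z i \<omega>)) \<le> (1 - t) * (\<Sum>i=1..n. loss w0 (Z i \<omega>)) + t * (\<Sum>i=1..n. loss w (Z i \<omega>))"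
        unfolding sum_distrib_left sum.distrib[symmetric] v
        using t by (intro sum_mono convex_onD[OF convex]) auto
      have "norm v \<le> (1 - t) * norm w0 + t * norm w"
        unfolding v using norm_triangle_ineq[of "(1 - t) *\<^sub>R w0" "t *\<^sub>R w"] t by simp
      then have "(norm v)\<^sup>2 \<le> ((1 - t) * norm w0 + t * norm w)\<^sup>2" by (simp add: power_mono)
      also have "\<dots> \<le> (1 - t) * (norm w0)\<^sup>2 + t * (norm w)\<^sup>2"
        using convex_onD[OF convex_power2, of t "norm w0" "norm w"] t by simp
      finally have norm_v: "(norm v)\<^sup>2 \<le> (1 - t) * (norm w0)\<^sup>2 + t * (norm w)\<^sup>2" .
      have "F v \<le> ((1 - t) * (\<Sum>i=1..n. loss w0 (Z i \<omega>)) + t * (\<Sum>i=1..n. loss w (Z i \<omega>))) / real n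
          + lam n * ((1 - t) * (norm w0)\<^sup>2 + t * (norm w)\<^sup>2)"
        unfolding F_def using sum_v norm_v lamn by (intro add_mono divide_right_mono mult_left_mono) auto
      also have "\<dots> = (1 - t) * F w0 + t * F w"
        using n_pos by (simp add: F_def field_simps)
      also have "\<dots> \<le> (1 - t) * F w0 + t * F w0"
        using obj t unfolding F_def by (intro add_left_mono mult_left_mono) auto
      finally have Fv: "F v \<le> F w0" by (simp add: algebra_simps)
      have "(\<Sum>i=1..n. X e i \<omega>) / real n
          = (\<Sum>i=1..n. loss v (Z i \<omega>)) / real n - (\<Sum>i=1..n. loss w0 (Z i \<omega>)) / real n"
        by (simp add: X_def v_def sum_subtractf diff_divide_distrib)
      then have "(\<Sum>i=1..n. X e i \<omega>) / real n \<le> lam n * ((norm w0)\<^sup>2 - (norm v)\<^sup>2)"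
        using Fv by (simp add: F_def algebra_simps)
      moreover have "r\<^sup>2 * c / 2 \<le> (\<Sum>i=1..n. X e i \<omega>) / real n"
        using low n_pos by (simp add: field_simps)
      moreover have "(norm w0)\<^sup>2 - (norm v)\<^sup>2 \<le> 2 * norm w0 * r"
      proof -
        have "norm w0 - r \<le> norm v" 
          using norm_triangle_ineq2[of w0 "- (r *\<^sub>R e)"] e r by (simp add: v_def)
        then have d: "norm w0 - norm v \<le> r" by simp
        show ?thesis
        proof (cases "norm v \<le> norm w0")
          case True
          have "(norm w0)\<^sup>2 - (norm v)\<^sup>2 = (norm w0 - norm v) * (norm w0 + norm v)"
            by (simp add: power2_eq_square algebra_simps)
          also have "\<dots> \<le> r * (norm w0 + norm w0)" using d True r by (intro mult_mono) auto
          finally show ?thesis by (simp add: algebra_simps)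
        next
          case False
          then have "(norm w0)\<^sup>2 \<le> (norm v)\<^sup>2" by (simp add: power_mono)
          moreover have "0 \<le> 2 * norm w0 * r" using r by simp
          ultimately show ?thesis by linarith
        qed
      qed
      ultimately have "r\<^sup>2 * c / 2 \<le> lam n * (2 * norm w0 * r)"
        using mult_left_mono[OF _ lamn(1)] by (meson order_trans)
      also have "\<dots> \<le> (\<bar>\<Lambda>\<bar> / real n) * (2 * norm w0 * r)"
        using order_trans[OF lamn(2) divide_right_mono[OF abs_ge_self]] r by (intro mult_right_mono) auto
      finally have "r * (r * c) \<le> r * (4 * \<bar>\<Lambda>\<bar> * norm w0 / real n)"
        by (simp add: power2_eq_square algebra_simps)
      then have "r * c \<le> 4 * \<bar>\<Lambda>\<bar> * norm w0 / real n"
        using r by (simp only: mult_le_cancel_left_pos)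
      moreover have "c / sqrt (real n) \<le> r * c" using mult_right_mono[OF r1, of c] \<open>0 < c\<close> by simp
      ultimately have "c / sqrt (real n) \<le> 4 * \<bar>\<Lambda>\<bar> * norm w0 / real n" by linarith
      then have "c / sqrt (real n) * (real n / c) \<le> 4 * \<bar>\<Lambda>\<bar> * norm w0 / real n * (real n / c)"
        using \<open>0 < c\<close> by (intro mult_right_mono) auto
      then have "sqrt (real n) \<le> 4 * \<bar>\<Lambda>\<bar> * norm w0 / c"
        using n_pos \<open>0 < c\<close> by (simp add: real_div_sqrt)
      then have "real n \<le> (4 * \<bar>\<Lambda>\<bar> * norm w0 / c)\<^sup>2"
        by (metis of_nat_0_le_iff real_sqrt_ge_0_iff power_mono real_sqrt_pow2)
      moreover have "(4 * \<bar>\<Lambda>\<bar> * norm w0 / c)\<^sup>2 < real n"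
      proof -
        have "(4 * \<bar>\<Lambda>\<bar> * norm w0 / c)\<^sup>2 \<le> real (nat \<lceil>(4 * \<bar>\<Lambda>\<bar> * norm w0 / c)\<^sup>2\<rceil>)" by linarith
        also have "\<dots> < real n" using n by (simp add: n1_def)
        finally show ?thesis .
      qed
      ultimately show False by simp
    qed
    then have "prob A \<le> prob (\<Union>u\<in>U. bad u)"
      using U(1) bad_sets by (intro finite_measure_mono) auto
    also have "\<dots> \<le> (\<Sum>u\<in>U. prob (bad u))"
      using U(1) bad_sets by (intro finite_measure_subadditive_finite) auto
    also have "\<dots> \<le> (\<Sum>u\<in>U. 2 * exp (- a * real n * r\<^sup>2))" by (intro sum_mono bad_prob)
    finally show "prob A \<le> 2 * real (card U) * exp (- a * real n * r\<^sup>2)" by simp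
  qed
qed

section \<open>Lebesgue measure in the plane and the law of the input\<close>

lemma borel_measurable_linear:
  fixes f :: "'a::euclidean_space \<Rightarrow> 'b::euclidean_space"
  assumes "linear f"
  shows "f \<in> borel_measurable borel"
  by (rule borel_measurable_continuous_onI[OF linear_continuous_on[OF assms[unfolded linear_conv_bounded_linear]]])

lemma distr_lborel_unimodular:
  fixes f g :: "real^2 \<Rightarrow> real^2"
  assumes "linear f" "linear g" "\<And>x. f (g x) = x" "\<And>x. g (f x) = x" "\<bar>det (matrix g)\<bar> = 1"
  shows "distr lborel borel f = lborel"
proof (rule lborel_eqI[symmetric])
  fix l u :: "real^2"
  assume le: "\<And>b. b \<in> Basis \<Longrightarrow> l \<bullet> b \<le> u \<bullet> b"
  have f[measurable]: "f \<in> borel_measurable borel"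
    by (rule borel_measurable_linear[OF assms(1)])
  have pre: "f -` box l u = g ` box l u"
  proof (intro set_eqI iffI)
    show "x \<in> g ` box l u" if "x \<in> f -` box l u" for x
      using that assms(4)[of x] by (metis imageI vimageD)
    show "x \<in> f -` box l u" if "x \<in> g ` box l u" for x
      using that assms(3) by auto
  qed
  have sets: "g ` box l u \<in> sets lborel"
    unfolding pre[symmetric] using measurable_sets[OF f, of "box l u"] by simp
  have "emeasure (distr lborel borel f) (box l u) = emeasure lborel (g ` box l u)"
    by (simp add: emeasure_distr pre)
  also have "\<dots> = emeasure lebesgue (g ` box l u)"
    using sets by simp
  also have "\<dots> = ennreal (measure lebesgue (g ` box l u))"
    using measurable_linear_image[OF assms(2), of "box l u"]
    by (intro emeasure_eq_measure2) (simp only: lmeasurable_box)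
  also have "\<dots> = ennreal (measure lebesgue (box l u))"
    using measure_linear_image[OF assms(2), of "box l u"] assms(5) by simp
  also have "\<dots> = ennreal (\<Prod>b\<in>Basis. (u - l) \<bullet> b)"
    using le by (simp add: measure_lborel_box_eq)
  finally show "emeasure (distr lborel borel f) (box l u) = ennreal (\<Prod>b\<in>Basis. (u - l) \<bullet> b)" .
qed simp

lemma prod_Basis_2: "(\<Prod>b\<in>Basis. (x :: real^2) \<bullet> b) = x $ 1 * x $ 2"
proof -
  have Basis: "(Basis :: (real^2) set) = {axis 1 1, axis 2 1}"
    unfolding Basis_vec_def UNIV_2 by auto
  show ?thesis unfolding Basis by (simp add: inner_axis axis_eq_axis)
qed

lemma cbox_2: "cbox (vector [a, c]) (vector [b, d] :: real^2) = {x. x $ 1 \<in> {a..b} \<and> x $ 2 \<in> {c..d}}"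
  by (auto simp: mem_box_cart forall_2)

lemma emeasure_rectangle:
  assumes "a \<le> b" "c \<le> d"
  shows "emeasure lborel {x::real^2. x $ 1 \<in> {a..b} \<and> x $ 2 \<in> {c..d}} = ennreal ((b - a) * (d - c))"
proof -
  have "\<forall>i. (vector [a, c]::real^2) $ i \<le> (vector [b, d]::real^2) $ i" using assms by (simp add: forall_2)
  then have "emeasure lborel (cbox (vector [a, c]) (vector [b, d]::real^2)) 
      = ennreal (\<Prod>i\<in>Basis. (vector [b, d] - vector [a, c]::real^2) \<bullet> i)"
    by (subst emeasure_lborel_cbox) (auto simp: Basis_vec_def inner_axis)
  then show ?thesis by (simp add: cbox_2 prod_Basis_2)
qed

text \<open>
  Strips along the diagonal direction are where the hinge has its kink; a shear turns them into rectangles.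
\<close>

lemma emeasure_parallelogram:
  assumes "a \<le> b" "c \<le> d"
  shows "emeasure lborel {x::real^2. x $ 1 \<in> {a..b} \<and> x $ 1 + x $ 2 \<in> {c..d}} = ennreal ((b - a) * (d - c))"
proof -
  define f :: "real^2 \<Rightarrow> real^2" where "f x = vector [x $ 1, x $ 1 + x $ 2]" for x
  define g :: "real^2 \<Rightarrow> real^2" where "g x = vector [x $ 1, x $ 2 - x $ 1]" for x
  have lin: "linear f" "linear g"
    by (rule linearI; simp add: f_def g_def vec_eq_iff forall_2 algebra_simps)+
  have distr: "distr lborel borel f = lborel"
    by (rule distr_lborel_unimodular[OF lin])
      (auto simp: f_def g_def vec_eq_iff forall_2 matrix_def det_2 axis_def)
  have [measurable]: "f \<in> borel_measurable borel"
    by (rule borel_measurable_linear[OF lin(1)])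
  have "emeasure lborel {x::real^2. x $ 1 \<in> {a..b} \<and> x $ 1 + x $ 2 \<in> {c..d}}
      = emeasure (distr lborel borel f) {x. x $ 1 \<in> {a..b} \<and> x $ 2 \<in> {c..d}}"
    by (subst emeasure_distr) (auto simp: f_def cbox_2[symmetric] intro!: arg_cong[where f="emeasure lborel"])
  then show ?thesis using emeasure_rectangle[OF assms] by (simp add: distr)
qed

definition flip :: "real^2 \<Rightarrow> real^2 \<Rightarrow> real^2" where
  "flip e x = (\<chi> i. e $ i * x $ i)"

definition swap :: "real^2 \<Rightarrow> real^2" where
  "swap x = vector [x $ 2, x $ 1]"

definition input_law :: "real \<Rightarrow> (real^2) measure" where
  "input_law \<gamma> = density lborel (\<lambda>x. ennreal (q_density \<gamma> x))"

lemma flip_nth [simp]: "flip e x $ i = e $ i * x $ i"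
  by (simp add: flip_def)

lemma swap_nth [simp]: "swap x $ 1 = x $ 2" "swap x $ 2 = x $ 1"
  by (simp_all add: swap_def)

lemma space_input_law [simp]: "space (input_law \<gamma>) = UNIV"
  and sets_input_law [simp, measurable_cong]: "sets (input_law \<gamma>) = sets borel"
  by (simp_all add: input_law_def)

lemma square_eq_cbox: "square = cbox (vector [-1, -1]) (vector [1, 1])"
  unfolding cbox_2 by (auto simp: square_def forall_2 abs_le_iff)

lemma square_sets [measurable]: "square \<in> sets borel"
  unfolding square_eq_cbox by simp

lemma emeasure_square: "emeasure lborel square = 4"
  unfolding square_eq_cbox cbox_2 by (subst emeasure_rectangle) auto

lemma vec_nth_measurable [measurable]: "(\<lambda>x::real^'n. x $ i) \<in> borel_measurable borel"
  by (intro borel_measurable_continuous_onI continuous_intros)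

lemma shape_measurable [measurable]: "shape \<gamma> \<in> borel_measurable borel"
  unfolding shape_def by measurable

lemma q_density_measurable [measurable]: "q_density \<gamma> \<in> borel_measurable borel"
  unfolding q_density_def by measurable

lemma linear_flip: "linear (flip e)"
  by (rule linearI) (auto simp: vec_eq_iff algebra_simps)

lemma linear_swap: "linear swap"
  by (rule linearI) (auto simp: vec_eq_iff forall_2 algebra_simps)

lemma flip_measurable [measurable]: "flip e \<in> borel_measurable borel"
  and swap_measurable [measurable]: "swap \<in> borel_measurable borel"
  by (rule borel_measurable_linear[OF linear_flip], rule borel_measurable_linear[OF linear_swap])

locale four_class =
  fixes \<gamma> \<theta> :: real
  assumes gamma: "0 \<le> \<gamma>" and theta: "1/4 < \<theta>" "\<theta> < 1"
begin

lemma shape_bounds: "0 \<le> shape \<gamma> x" "shape \<gamma> x \<le> indicator square x"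
proof -
  show "0 \<le> shape \<gamma> x" by (simp add: shape_def)
  have "min \<bar>x $ 1\<bar> \<bar>x $ 2\<bar> powr \<gamma> \<le> 1 powr \<gamma>" if "x \<in> square"
    using that gamma by (intro powr_mono2) (auto simp: square_def min_def)
  then show "shape \<gamma> x \<le> indicator square x" by (auto simp: shape_def indicator_def)
qed

lemma shape_integrable: "integrable lborel (shape \<gamma>)"
  by (rule Bochner_Integration.integrable_bound[of _ "indicator square :: _ \<Rightarrow> real"])
    (use shape_bounds emeasure_square in \<open>auto simp: shape_bounds(1) integrable_indicator_iff\<close>)

lemma shape_integral_pos: "0 < (\<integral>x. shape \<gamma> x \<partial>lborel)"
proof -
  define A :: "(real^2) set" where "A = {x. x $ 1 \<in> {1/2..1} \<and> x $ 2 \<in> {1/2..1}}"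
  have A: "A \<in> sets borel" "emeasure lborel A = ennreal (1/4)"
    unfolding A_def using emeasure_rectangle[of "1/2" 1 "1/2" 1]
    by (auto simp: cbox_2[symmetric])
  have "(1/2) powr \<gamma> * (1/4) = (\<integral>x. (1/2) powr \<gamma> * indicator A x \<partial>lborel)"
    using A by (simp add: measure_def)
  also have "\<dots> \<le> (\<integral>x. shape \<gamma> x \<partial>lborel)"
  proof (rule integral_mono[OF _ shape_integrable])
    show "integrable lborel (\<lambda>x. (1 / 2) powr \<gamma> * indicator A x :: real)"
      using A by (intro integrable_mult_right) (auto simp: integrable_indicator_iff)
    show "(1 / 2) powr \<gamma> * indicator A x \<le> shape \<gamma> x" for x
      using gamma shape_bounds(1)[of x]
      by (auto simp: A_def shape_def square_def forall_2 indicator_def intro!: powr_mono2)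
  qed
  finally show ?thesis by (smt (verit) powr_gt_zero divide_pos_pos mult_pos_pos)
qed

lemma kappa_pos: "0 < kappa \<gamma>"
  using shape_integral_pos by (simp add: kappa_def)

lemma q_density_nonneg: "0 \<le> q_density \<gamma> x"
  using kappa_pos shape_bounds(1)[of x] by (simp add: q_density_def)

lemma prob_space_input_law: "prob_space (input_law \<gamma>)"
proof (rule prob_spaceI)
  have "emeasure (input_law \<gamma>) (space (input_law \<gamma>)) = (\<integral>\<^sup>+x. ennreal (q_density \<gamma> x) \<partial>lborel)"
    by (simp add: input_law_def emeasure_density)
  also have "\<dots> = ennreal (\<integral>x. q_density \<gamma> x \<partial>lborel)"
    using shape_integrable q_density_nonneg
    by (intro nn_integral_eq_integral) (auto simp: q_density_def)
  also have "(\<integral>x. q_density \<gamma> x \<partial>lborel) = 1"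
    using shape_integral_pos by (simp add: q_density_def kappa_def)
  finally show "emeasure (input_law \<gamma>) (space (input_law \<gamma>)) = 1" by simp
qed

sublocale PX: prob_space "input_law \<gamma>" by (rule prob_space_input_law)

lemma AE_input_law_square: "AE x in input_law \<gamma>. x \<in> square"
  unfolding input_law_def
  by (subst AE_density) (auto simp: q_density_def shape_def indicator_def)

text \<open>
  This is where \<open>\<gamma>\<close> enters the rate: near the axes a bound \<open>m\<close> on the distance to them also bounds
  the density, by a multiple of \<open>m\<^sup>\<gamma>\<close>.
\<close>

lemma measure_input_law_le:
  assumes "A \<in> sets borel" "B \<in> sets borel" "emeasure lborel B = ennreal v" "0 \<le> v" "0 \<le> m"
    and "A \<inter> square \<subseteq> B" and "\<And>x. x \<in> A \<inter> square \<Longrightarrow> min \<bar>x $ 1\<bar> \<bar>x $ 2\<bar> \<le> m"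
  shows "measure (input_law \<gamma>) A \<le> kappa \<gamma> * m powr \<gamma> * v"
proof -
  have "ennreal (measure (input_law \<gamma>) A) = emeasure (input_law \<gamma>) A"
    by (simp add: PX.emeasure_eq_measure)
  also have "\<dots> = (\<integral>\<^sup>+x. ennreal (q_density \<gamma> x) * indicator A x \<partial>lborel)"
    unfolding input_law_def using assms(1) by (subst emeasure_density) auto
  also have "\<dots> \<le> (\<integral>\<^sup>+x. ennreal (kappa \<gamma> * m powr \<gamma>) * indicator B x \<partial>lborel)"
  proof (rule nn_integral_mono)
    fix x :: "real^2"
    show "ennreal (q_density \<gamma> x) * indicator A x \<le> ennreal (kappa \<gamma> * m powr \<gamma>) * indicator B x"
    proof (cases "x \<in> A \<inter> square")
      case True
      then have "q_density \<gamma> x \<le> kappa \<gamma> * m powr \<gamma>"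
        unfolding q_density_def shape_def using assms(7)[OF True] gamma kappa_pos assms(5)
        by (intro mult_left_mono) (auto intro!: powr_mono2)
      then show ?thesis using True assms(6) by (auto intro!: ennreal_leI)
    next
      case False
      then show ?thesis by (auto simp: q_density_def shape_def indicator_def)
    qed
  qed
  also have "\<dots> = ennreal (kappa \<gamma> * m powr \<gamma> * v)"
    using assms(2-4) kappa_pos by (simp add: nn_integral_cmult ennreal_mult)
  finally show ?thesis using kappa_pos assms(4) by simp
qed

lemma measure_input_law_ge:
  assumes "A \<in> sets borel" "emeasure lborel A = ennreal v" "0 \<le> v" "0 \<le> m"
    and "\<And>x. x \<in> A \<Longrightarrow> x \<in> square \<and> m \<le> min \<bar>x $ 1\<bar> \<bar>x $ 2\<bar>"
  shows "kappa \<gamma> * m powr \<gamma> * v \<le> measure (input_law \<gamma>) A"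
proof -
  have "ennreal (kappa \<gamma> * m powr \<gamma> * v) = (\<integral>\<^sup>+x. ennreal (kappa \<gamma> * m powr \<gamma>) * indicator A x \<partial>lborel)"
    using assms(1-3) kappa_pos by (simp add: nn_integral_cmult ennreal_mult)
  also have "\<dots> \<le> (\<integral>\<^sup>+x. ennreal (q_density \<gamma> x) * indicator A x \<partial>lborel)"
  proof (rule nn_integral_mono)
    fix x :: "real^2"
    have "kappa \<gamma> * m powr \<gamma> \<le> q_density \<gamma> x" if "x \<in> A"
      unfolding q_density_def shape_def using assms(5)[OF that] gamma kappa_pos assms(4)
      by (intro mult_left_mono) (auto intro!: powr_mono2)
    then show "ennreal (kappa \<gamma> * m powr \<gamma>) * indicator A x \<le> ennreal (q_density \<gamma> x) * indicator A x"
      by (auto simp: indicator_def intro!: ennreal_leI)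
  qed
  also have "\<dots> = emeasure (input_law \<gamma>) A"
    unfolding input_law_def using assms(1) by (subst emeasure_density) auto
  also have "\<dots> = ennreal (measure (input_law \<gamma>) A)"
    by (simp add: PX.emeasure_eq_measure)
  finally show ?thesis by simp
qed

lemma distr_input_law:
  assumes [measurable]: "f \<in> borel_measurable borel"
    and "distr lborel borel f = lborel" and "\<And>x. shape \<gamma> (f x) = shape \<gamma> x"
  shows "distr (input_law \<gamma>) borel f = input_law \<gamma>"
proof -
  have "input_law \<gamma> = density (distr lborel borel f) (\<lambda>x. ennreal (q_density \<gamma> x))"
    by (simp add: input_law_def assms(2))
  also have "\<dots> = distr (density lborel (\<lambda>x. ennreal (q_density \<gamma> (f x)))) borel f"
    by (subst density_distr) auto
  also have "\<dots> = distr (input_law \<gamma>) borel f"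
    by (simp add: input_law_def q_density_def assms(3))
  finally show ?thesis by simp
qed

lemma distr_input_law_flip:
  assumes "\<And>i. \<bar>e $ i\<bar> = 1"
  shows "distr (input_law \<gamma>) borel (flip e) = input_law \<gamma>"
proof (rule distr_input_law)
  have sq: "e $ i * e $ i = 1" for i using assms[of i] by (metis abs_mult_self_eq mult_1)
  show "distr lborel borel (flip e) = lborel"
  proof (rule distr_lborel_unimodular[OF linear_flip linear_flip])
    show "flip e (flip e x) = x" "flip e (flip e x) = x" for x
      using sq by (simp_all add: vec_eq_iff mult.assoc[symmetric])
    show "\<bar>det (matrix (flip e))\<bar> = 1"
      using assms by (simp add: matrix_def det_2 axis_def abs_mult)
  qed
  show "shape \<gamma> (flip e x) = shape \<gamma> x" for x
    using assms by (simp add: shape_def square_def abs_mult indicator_def)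
qed simp

lemma distr_input_law_swap: "distr (input_law \<gamma>) borel swap = input_law \<gamma>"
proof (rule distr_input_law)
  show "distr lborel borel swap = lborel"
    by (rule distr_lborel_unimodular[OF linear_swap linear_swap])
      (simp_all add: vec_eq_iff forall_2 matrix_def det_2 axis_def)
  show "shape \<gamma> (swap x) = shape \<gamma> x" for x
    by (auto simp: shape_def square_def forall_2 indicator_def min.commute)
qed simp

lemma AE_input_law_off_axes: "AE x in input_law \<gamma>. x $ i \<noteq> 0"
proof -
  have null: "{x::real^2. x $ i = 0} \<in> null_sets lborel"
  proof -
    have "negligible {x::real^2. axis i 1 \<bullet> x = 0}"
      by (rule negligible_hyperplane) (simp add: axis_eq_0_iff)
    then have "{x::real^2. x $ i = 0} \<in> null_sets lebesgue"
      by (simp add: negligible_iff_null_sets inner_axis' cart_eq_inner_axis inner_commute)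
    then show ?thesis by (simp add: null_sets_completion_iff)
  qed
  have "AE x in lborel. x $ i \<noteq> (0::real)"
    using AE_not_in[OF null] by (auto elim: eventually_mono)
  then show ?thesis
    unfolding input_law_def by (subst AE_density) (auto elim: eventually_mono)
qed

end

section \<open>First-order expansion of the hinge risk\<close>

definition hinge_risk :: "real \<Rightarrow> real \<Rightarrow> 4 \<Rightarrow> real^2 \<Rightarrow> real" where
  "hinge_risk \<gamma> \<theta> j v = (\<integral>x. (1 - cond_prob_label \<theta> x j) * max (v \<bullet> x + 1) 0 \<partial>input_law \<gamma>)"

text \<open>
  The second-order remainder of the positive part at \<open>t\<close>. The subgradient 1 is chosen at \<open>t = 0\<close>, so that the
  first-order term is the full linear function on the whole square as long as \<open>t\<close> is nonnegative there, which covers the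
  boundary case \<open>s = 1/2\<close>.
\<close>

definition kink :: "real \<Rightarrow> real \<Rightarrow> real" where
  "kink t h = max (t + h) 0 - max t 0 - (if 0 \<le> t then h else 0)"

lemma kink_nonneg: "0 \<le> kink t h"
  by (simp add: kink_def max_def)

lemma kink_le: "kink t h \<le> (if \<bar>t\<bar> \<le> \<bar>h\<bar> then \<bar>h\<bar> else 0)"
  by (auto simp: kink_def max_def abs_if)

lemma kink_ge_pos: "- h / 2 \<le> t \<Longrightarrow> t < 0 \<Longrightarrow> h / 2 \<le> kink t h"
  by (simp add: kink_def max_def)

lemma kink_ge_neg: "0 \<le> t \<Longrightarrow> t \<le> - h / 2 \<Longrightarrow> - h / 2 \<le> kink t h"
  by (simp add: kink_def max_def)

lemma inner_2: "(x::real^2) \<bullet> y = x $ 1 * y $ 1 + x $ 2 * y $ 2"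
  by (simp add: inner_vec_def sum_2)

lemma norm_le_2: "norm (x::real^2) \<le> \<bar>x $ 1\<bar> + \<bar>x $ 2\<bar>"
  using norm_le_l1_cart[of x] by (simp add: sum_2)

lemma norm_square: "x \<in> square \<Longrightarrow> norm x \<le> 2"
  using norm_le_2[of x] by (auto simp: square_def forall_2)

lemma inner_square: "x \<in> square \<Longrightarrow> \<bar>u \<bullet> x\<bar> \<le> 2 * norm u"
  using Cauchy_Schwarz_ineq2[of u x] mult_left_mono[OF norm_square[of x], of "norm u"] by (simp add: mult.commute)

lemma S_region_sets [measurable]: "S_region j \<in> sets borel"
proof -
  have [measurable]: "{x::real^2. x $ 1 \<ge> 0 \<and> x $ 2 \<ge> 0} \<in> sets borel" "{x::real^2. x $ 1 \<ge> 0 \<and> x $ 2 < 0} \<in> sets borel"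
    "{x::real^2. x $ 1 < 0 \<and> x $ 2 \<ge> 0} \<in> sets borel" "{x::real^2. x $ 1 < 0 \<and> x $ 2 < 0} \<in> sets borel"
    by measurable
  then show ?thesis by (simp add: S_region_def)
qed

lemma cond_prob_label_measurable [measurable]: "(\<lambda>x. cond_prob_label \<theta> x j) \<in> borel_measurable borel"
  unfolding cond_prob_label_def by measurable

context four_class
begin

lemma weight_bounds: "1 - \<theta> \<le> 1 - cond_prob_label \<theta> x j" "1 - cond_prob_label \<theta> x j \<le> 1"
  using theta by (auto simp: cond_prob_label_def)

lemma weight_nonneg: "0 \<le> 1 - cond_prob_label \<theta> x j"
  using weight_bounds[of x j] theta by simp

lemma integrable_input_law:
  fixes K :: real
  assumes [measurable]: "f \<in> borel_measurable borel" and "\<And>x. x \<in> square \<Longrightarrow> \<bar>f x\<bar> \<le> K"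
  shows "integrable (input_law \<gamma>) f"
  by (rule PX.integrable_const_bound[of _ K])
    (use AE_input_law_square assms(2) in \<open>auto elim!: eventually_mono\<close>)

lemma weighted_le: "0 \<le> y \<Longrightarrow> (1 - cond_prob_label \<theta> x j) * y \<le> y"
  using mult_right_mono[OF weight_bounds(2)[of x j], of y] by simp

lemma weighted_abs_le: "\<bar>(1 - cond_prob_label \<theta> x j) * y\<bar> \<le> \<bar>y\<bar>"
  using weighted_le[of "\<bar>y\<bar>" x j] weight_nonneg[of x j] by (simp add: abs_mult)

lemma integrable_weighted:
  assumes [measurable]: "f \<in> borel_measurable borel" and "\<And>x. x \<in> square \<Longrightarrow> \<bar>f x\<bar> \<le> K"
  shows "integrable (input_law \<gamma>) (\<lambda>x. (1 - cond_prob_label \<theta> x j) * f x)"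
proof (rule integrable_input_law)
  show "\<bar>(1 - cond_prob_label \<theta> x j) * f x\<bar> \<le> K" if "x \<in> square" for x
    using weighted_abs_le[of x j "f x"] assms(2)[OF that] by linarith
qed measurable

lemma hinge_bound: "x \<in> square \<Longrightarrow> \<bar>max (v \<bullet> x + 1) 0\<bar> \<le> 2 * norm v + 1"
  using inner_square[of x v] by auto

lemma hinge_integrable:
  "integrable (input_law \<gamma>) (\<lambda>x. (1 - cond_prob_label \<theta> x j) * max (v \<bullet> x + 1) 0)"
  by (rule integrable_weighted[OF _ hinge_bound]) auto

lemma kink_measurable [measurable]: "(\<lambda>x::real^2. kink (v \<bullet> x + 1) (u \<bullet> x)) \<in> borel_measurable borel"
  unfolding kink_def by measurable

lemma kink_integrable:
  "integrable (input_law \<gamma>) (\<lambda>x. (1 - cond_prob_label \<theta> x j) * kink (v \<bullet> x + 1) (u \<bullet> x))"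
proof (rule integrable_weighted)
  show "\<bar>kink (v \<bullet> x + 1) (u \<bullet> x)\<bar> \<le> 2 * norm u" if "x \<in> square" for x
    using kink_nonneg[of "v \<bullet> x + 1" "u \<bullet> x"] kink_le[of "v \<bullet> x + 1" "u \<bullet> x"] inner_square[OF that, of u]
    by (auto split: if_splits)
qed simp

lemma slope_integrable:
  "integrable (input_law \<gamma>) (\<lambda>x. (1 - cond_prob_label \<theta> x j) * (if 0 \<le> v \<bullet> x + 1 then u \<bullet> x else 0))"
  by (rule integrable_weighted[of _ "2 * norm u"]) (use inner_square in auto)

text \<open>
  An exact first-order expansion: the kink of the positive part enters only through a
  nonnegative remainder.
\<close>

lemma hinge_risk_expand:
  "hinge_risk \<gamma> \<theta> j (v + u) - hinge_risk \<gamma> \<theta> j v =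
    (\<integral>x. (1 - cond_prob_label \<theta> x j) * (if 0 \<le> v \<bullet> x + 1 then u \<bullet> x else 0) \<partial>input_law \<gamma>)
    + (\<integral>x. (1 - cond_prob_label \<theta> x j) * kink (v \<bullet> x + 1) (u \<bullet> x) \<partial>input_law \<gamma>)"
  unfolding hinge_risk_def
  using hinge_integrable kink_integrable slope_integrable
  by (simp add: Bochner_Integration.integral_diff[symmetric] Bochner_Integration.integral_add[symmetric]
      del: Bochner_Integration.integral_diff Bochner_Integration.integral_add)
    (auto intro!: Bochner_Integration.integral_cong simp: kink_def inner_add_left algebra_simps)

text \<open>
  The remainder is at most \<open>\<bar>u \<bullet> x\<bar>\<close> and lives on a strip of width of order \<open>norm u\<close> around the
  line \<open>s (x\<^sub>1 + x\<^sub>2) = -1\<close>; each contributes one factor \<open>norm u\<close>.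
\<close>

lemma kink_integral_upper:
  assumes "0 < s"
  shows "(\<integral>x. (1 - cond_prob_label \<theta> x j) * kink (vector [s, s] \<bullet> x + 1) (u \<bullet> x) \<partial>input_law \<gamma>)
    \<le> 16 * kappa \<gamma> / s * (norm u)\<^sup>2"
proof -
  define A where "A = {x::real^2. x \<in> square \<and> \<bar>vector [s, s] \<bullet> x + 1\<bar> \<le> 2 * norm u}"
  define B where "B = {x::real^2. x $ 1 \<in> {-1..1} \<and> x $ 1 + x $ 2 \<in> {(- 1 - 2 * norm u) / s..(- 1 + 2 * norm u) / s}}"
  have A[measurable]: "A \<in> sets borel" unfolding A_def by measurable
  have B: "B \<in> sets borel" unfolding B_def by measurable
  have "(\<integral>x. (1 - cond_prob_label \<theta> x j) * kink (vector [s, s] \<bullet> x + 1) (u \<bullet> x) \<partial>input_law \<gamma>)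
      \<le> (\<integral>x. 2 * norm u * indicator A x \<partial>input_law \<gamma>)"
  proof (rule integral_mono_AE[OF kink_integrable])
    show "integrable (input_law \<gamma>) (\<lambda>x. 2 * norm u * indicator A x :: real)"
      by (rule integrable_input_law[of _ "2 * norm u"]) (auto simp: indicator_def)
    show "AE x in input_law \<gamma>. (1 - cond_prob_label \<theta> x j) * kink (vector [s, s] \<bullet> x + 1) (u \<bullet> x)
        \<le> 2 * norm u * indicator A x"
      using AE_input_law_square
    proof eventually_elim
      fix x :: "real^2" assume x: "x \<in> square"
      have "(1 - cond_prob_label \<theta> x j) * kink (vector [s, s] \<bullet> x + 1) (u \<bullet> x) \<le> kink (vector [s, s] \<bullet> x + 1) (u \<bullet> x)"
        by (rule weighted_le[OF kink_nonneg])
      also have "\<dots> \<le> 2 * norm u * indicator A x"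
        using kink_le[of "vector [s, s] \<bullet> x + 1" "u \<bullet> x"] inner_square[OF x, of u] x
        by (auto simp: A_def indicator_def split: if_splits)
      finally show "(1 - cond_prob_label \<theta> x j) * kink (vector [s, s] \<bullet> x + 1) (u \<bullet> x) \<le> 2 * norm u * indicator A x" .
    qed
  qed
  also have "\<dots> = 2 * norm u * measure (input_law \<gamma>) A" by simp
  also have "\<dots> \<le> 2 * norm u * (kappa \<gamma> * 1 powr \<gamma> * (8 * norm u / s))"
  proof (intro mult_left_mono measure_input_law_le[OF _ B])
    have "emeasure lborel B = ennreal ((1 - - 1) * ((- 1 + 2 * norm u) / s - (- 1 - 2 * norm u) / s))"
      unfolding B_def using assms by (intro emeasure_parallelogram) (auto simp: divide_right_mono)
    also have "(1 - - 1) * ((- 1 + 2 * norm u) / s - (- 1 - 2 * norm u) / s) = 8 * norm u / s"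
      using assms by (simp add: field_simps)
    finally show "emeasure lborel B = ennreal (8 * norm u / s)" .
    show "A \<inter> square \<subseteq> B"
      using assms by (auto simp: A_def B_def square_def forall_2 inner_2 abs_le_iff field_simps)
  qed (use assms in \<open>auto simp: square_def forall_2\<close>)
  also have "\<dots> = 16 * kappa \<gamma> / s * (norm u)\<^sup>2" by (simp add: power2_eq_square)
  finally show ?thesis .
qed

text \<open>
  For \<open>s > 1/2\<close> the line \<open>s (x\<^sub>1 + x\<^sub>2) = -1\<close> passes through the interior point \<open>(-m, -m)\<close> of the square, away
  from the axes. Write \<open>x\<^sub>1 = -m + y\<close> and \<open>x\<^sub>1 + x\<^sub>2 = -2 m + p\<close>. Then the hinge argument is \<open>s p\<close> and
  \<open>u \<bullet> x = -m \<alpha> + \<beta> y + u\<^sub>2 p\<close>. Choosing the sign \<open>\<zeta>\<close> of \<open>y\<close> such that \<open>-m \<alpha>\<close> and \<open>\<beta> y\<close> have a common sign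
  \<open>\<eta>\<close>, their sum is at least \<open>k\<close> in absolute value, where \<open>k\<close> is comparable to \<open>norm u\<close>, and \<open>u\<^sub>2 p\<close> is at
  most \<open>k / 2\<close>. Letting \<open>p\<close> run through an interval of length of order \<open>k\<close> on the side of the line on which
  adding \<open>u \<bullet> x\<close> crosses the kink gives a parallelogram of area of order \<open>k\<close> on which the
  remainder is at least \<open>k / 4\<close>.
\<close>

lemma kink_integral_lower:
  assumes "1/2 < s"
  obtains c r0 where "0 < c" "0 < r0"
    "\<And>u. norm u \<le> r0 \<Longrightarrow> c * (norm u)\<^sup>2
      \<le> (\<integral>x. (1 - cond_prob_label \<theta> x j) * kink (vector [s, s] \<bullet> x + 1) (u \<bullet> x) \<partial>input_law \<gamma>)"
proof -
  define m where "m = 1 / (2 * s)"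
  have m: "0 < m" "m < 1" "s * m = 1/2" using assms by (auto simp: m_def field_simps)
  define \<tau> where "\<tau> = min (m / 2) (1 - m)"
  have \<tau>: "0 < \<tau>" "\<tau> \<le> m / 2" "\<tau> \<le> 1 - m"
    using m unfolding \<tau>_def by (simp, intro min.cobounded1, intro min.cobounded2)
  define q0 where "q0 = kappa \<gamma> * (m / 2) powr \<gamma>"
  have q0: "0 < q0" using kappa_pos m by (simp add: q0_def)
  define c where "c = (1 - \<theta>) * q0 * \<tau> ^ 3 / (2048 * s)"
  show thesis
  proof (rule that[of c "s * \<tau> / 4"])
    show "0 < c" using theta q0 \<tau> assms by (simp add: c_def)
    show "0 < s * \<tau> / 4" using \<tau> assms by simp
    fix u :: "real^2" assume u: "norm u \<le> s * \<tau> / 4"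
    define \<alpha> where "\<alpha> = u $ 1 + u $ 2"
    define \<beta> where "\<beta> = u $ 1 - u $ 2"
    define k where "k = m * \<bar>\<alpha>\<bar> + \<tau> / 4 * \<bar>\<beta>\<bar>"
    define \<eta> :: real where "\<eta> = (if 0 < \<alpha> then - 1 else 1)"
    define \<zeta> :: real where "\<zeta> = (if 0 \<le> \<eta> * \<beta> then 1 else - 1)"
    define d where "d = k / (8 * s)"
    define J1 where "J1 = {x1. \<zeta> * (x1 + m) \<in> {\<tau> / 4..\<tau> / 2}}"
    define J2 where "J2 = {p. - \<eta> * (p + 2 * m) \<in> {d..2 * d}}"
    \<comment> \<open>For \<open>k > 0\<close>, the interval \<open>J2\<close> stays away from the line \<open>p = 0\<close>, which keeps the hinge argument off its kink.\<close>
    define A where "A = {x::real^2. x $ 1 \<in> J1 \<and> x $ 1 + x $ 2 \<in> J2}"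
    have sg: "\<eta> = 1 \<or> \<eta> = - 1" "\<zeta> = 1 \<or> \<zeta> = - 1" by (auto simp: \<eta>_def \<zeta>_def)
    have "\<bar>u $ 1\<bar> \<le> norm u" "\<bar>u $ 2\<bar> \<le> norm u" by (rule component_le_norm_cart)+
    then have ab: "\<bar>\<alpha>\<bar> + \<bar>\<beta>\<bar> \<le> 4 * norm u" "norm u \<le> \<bar>\<alpha>\<bar> + \<bar>\<beta>\<bar>"
      using norm_le_2[of u] by (auto simp: \<alpha>_def \<beta>_def)
    have k0: "0 \<le> k" using m \<tau> by (simp add: k_def)
    have kup: "k \<le> 4 * norm u"
    proof -
      have "m * \<bar>\<alpha>\<bar> \<le> 1 * \<bar>\<alpha>\<bar>" "\<tau> / 4 * \<bar>\<beta>\<bar> \<le> 1 * \<bar>\<beta>\<bar>" using m \<tau> by (intro mult_right_mono; simp)+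
      then show ?thesis using ab by (simp add: k_def)
    qed
    have klow: "\<tau> / 4 * norm u \<le> k"
    proof -
      have "\<tau> / 4 * \<bar>\<alpha>\<bar> \<le> m * \<bar>\<alpha>\<bar>" using m \<tau> by (intro mult_right_mono) auto
      moreover have "\<tau> / 4 * norm u \<le> \<tau> / 4 * (\<bar>\<alpha>\<bar> + \<bar>\<beta>\<bar>)" using ab \<tau> by (intro mult_left_mono) auto
      ultimately show ?thesis by (simp add: k_def algebra_simps)
    qed
    have d: "0 \<le> d" "s * d = k / 8" "2 * d \<le> \<tau> / 4"
      using k0 kup u assms by (auto simp: d_def field_simps)
    have J1: "\<exists>l. J1 = {l..l + \<tau> / 4}"
    proof -
      have "J1 = {\<tau> / 4 - m..\<tau> / 4 - m + \<tau> / 4}" if "\<zeta> = 1" using that by (auto simp: J1_def)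
      moreover have "J1 = {- \<tau> / 2 - m..- \<tau> / 2 - m + \<tau> / 4}" if "\<zeta> = - 1" using that by (auto simp: J1_def)
      ultimately show ?thesis using sg by blast
    qed
    have J2: "\<exists>l. J2 = {l..l + d}"
    proof -
      have "J2 = {- 2 * m - 2 * d..- 2 * m - 2 * d + d}" if "\<eta> = 1"
        using that by (auto simp: J2_def)
      moreover have "J2 = {d - 2 * m..d - 2 * m + d}" if "\<eta> = - 1"
        using that by (auto simp: J2_def)
      ultimately show ?thesis using sg by blast
    qed
    obtain l1 l2 where l: "J1 = {l1..l1 + \<tau> / 4}" "J2 = {l2..l2 + d}" using J1 J2 by blast
    have A_sets[measurable]: "A \<in> sets borel" unfolding A_def l by measurable
    have A_lborel: "emeasure lborel A = ennreal (\<tau> / 4 * d)"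
      unfolding A_def l using emeasure_parallelogram[of l1 "l1 + \<tau> / 4" l2 "l2 + d"] \<tau> d by simp
    have A_prop: "x \<in> square \<and> m / 2 \<le> min \<bar>x $ 1\<bar> \<bar>x $ 2\<bar> \<and> k / 4 \<le> kink (vector [s, s] \<bullet> x + 1) (u \<bullet> x)"
      if x: "x \<in> A" for x
    proof -
      define y where "y = x $ 1 + m"
      define p where "p = x $ 1 + x $ 2 + 2 * m"
      have y: "\<tau> / 4 \<le> \<zeta> * y" "\<zeta> * y \<le> \<tau> / 2" and p: "d \<le> - \<eta> * p" "- \<eta> * p \<le> 2 * d"
        using x by (auto simp: A_def J1_def J2_def y_def p_def algebra_simps)
      have ay: "\<bar>y\<bar> = \<zeta> * y" "\<bar>y\<bar> \<le> \<tau> / 2" "\<tau> / 4 \<le> \<bar>y\<bar>" using y \<tau> sg by auto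
      have ap: "\<bar>p\<bar> \<le> 2 * d" using p sg d by auto
      have x12: "x $ 1 = y - m" "x $ 2 = p - y - m" by (auto simp: y_def p_def)
      have y2: "\<bar>p - y\<bar> \<le> \<tau>" using ay ap d(3) \<tau> by linarith
      have sq: "x \<in> square" "m / 2 \<le> min \<bar>x $ 1\<bar> \<bar>x $ 2\<bar>"
        using ay y2 \<tau> m by (auto simp: square_def forall_2 x12)
      have t: "vector [s, s] \<bullet> x + 1 = s * p"
        using m by (simp add: inner_2 x12 algebra_simps)
      have h: "u \<bullet> x = - m * \<alpha> + \<beta> * y + u $ 2 * p"
        by (simp add: inner_2 x12 \<alpha>_def \<beta>_def algebra_simps)
      have h1: "\<eta> * (- m * \<alpha>) = m * \<bar>\<alpha>\<bar>" by (simp add: \<eta>_def)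
      have h2: "\<eta> * (\<beta> * y) = \<bar>\<beta>\<bar> * \<bar>y\<bar>"
      proof -
        have "\<eta> * \<beta> = \<zeta> * \<bar>\<beta>\<bar>" using sg by (auto simp: \<zeta>_def \<eta>_def split: if_splits)
        then show ?thesis using ay(1) sg(2) by (metis mult.assoc mult.commute)
      qed
      have h3: "\<bar>u $ 2 * p\<bar> \<le> k / 2"
      proof -
        have "\<bar>u $ 2\<bar> * \<bar>p\<bar> \<le> ((\<bar>\<alpha>\<bar> + \<bar>\<beta>\<bar>) / 2) * (\<tau> / 4)"
          using ap d(3) by (intro mult_mono) (auto simp: \<alpha>_def \<beta>_def)
        also have "\<dots> \<le> k / 2"
        proof -
          have "\<tau> / 4 * \<bar>\<alpha>\<bar> \<le> m * \<bar>\<alpha>\<bar>" using m \<tau> by (intro mult_right_mono) auto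
          then show ?thesis by (simp add: k_def algebra_simps)
        qed
        finally show ?thesis by (simp add: abs_mult)
      qed
      have h4: "\<tau> / 4 * \<bar>\<beta>\<bar> \<le> \<bar>\<beta>\<bar> * \<bar>y\<bar>"
        using mult_right_mono[OF ay(3), of "\<bar>\<beta>\<bar>"] by (simp add: mult.commute)
      have h5: "- (k / 2) \<le> \<eta> * (u $ 2 * p)" using h3 sg(1) by (auto simp: abs_le_iff)
      have hk: "k / 2 \<le> \<eta> * (u \<bullet> x)"
        unfolding h distrib_left h1 h2 using h4 h5 k_def by linarith
      have sp: "k / 8 \<le> - \<eta> * (s * p)" "- \<eta> * (s * p) \<le> k / 4"
        using mult_left_mono[OF p(1), of s] mult_left_mono[OF p(2), of s] d(2) assms by (auto simp: algebra_simps)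
      have "k / 4 \<le> kink (s * p) (u \<bullet> x)"
      proof (cases "k = 0")
        case True then show ?thesis using kink_nonneg by simp
      next
        case False
        then have k: "0 < k" using k0 by simp
        from sg(1) show ?thesis
        proof
          assume e: "\<eta> = 1"
          have "(u \<bullet> x) / 2 \<le> kink (s * p) (u \<bullet> x)"
            by (rule kink_ge_pos) (use e hk sp k in auto)
          then show ?thesis using hk e by simp
        next
          assume e: "\<eta> = - 1"
          have "- (u \<bullet> x) / 2 \<le> kink (s * p) (u \<bullet> x)"
            by (rule kink_ge_neg) (use e hk sp k in auto)
          then show ?thesis using hk e by simp
        qed
      qed
      then show ?thesis using sq t by simp
    qed
    have PA: "q0 * (\<tau> / 4 * d) \<le> measure (input_law \<gamma>) A"
      unfolding q0_def using A_prop m \<tau> d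
      by (intro measure_input_law_ge[OF A_sets A_lborel]) auto
    have "c * (norm u)\<^sup>2 = (1 - \<theta>) * q0 * \<tau> / (128 * s) * (\<tau> / 4 * norm u)\<^sup>2"
      by (simp add: c_def power2_eq_square power3_eq_cube)
    also have "\<dots> \<le> (1 - \<theta>) * q0 * \<tau> / (128 * s) * k\<^sup>2"
      using theta q0 \<tau> assms klow by (intro mult_left_mono power_mono) auto
    also have "\<dots> = (1 - \<theta>) * (k / 4) * (q0 * (\<tau> / 4 * d))"
      by (simp add: power2_eq_square d_def)
    also have "\<dots> \<le> (1 - \<theta>) * (k / 4) * measure (input_law \<gamma>) A"
      using PA theta k0 by (intro mult_left_mono) auto
    also have "\<dots> = (\<integral>x. (1 - \<theta>) * (k / 4) * indicator A x \<partial>input_law \<gamma>)" by simp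
    also have "\<dots> \<le> (\<integral>x. (1 - cond_prob_label \<theta> x j) * kink (vector [s, s] \<bullet> x + 1) (u \<bullet> x) \<partial>input_law \<gamma>)"
    proof (rule integral_mono[OF _ kink_integrable])
      show "integrable (input_law \<gamma>) (\<lambda>x. (1 - \<theta>) * (k / 4) * indicator A x :: real)"
        by (intro integrable_mult_right PX.integrable_const_bound[of _ 1]) (auto simp: indicator_def)
      show "(1 - \<theta>) * (k / 4) * indicator A x
          \<le> (1 - cond_prob_label \<theta> x j) * kink (vector [s, s] \<bullet> x + 1) (u \<bullet> x)" for x
      proof (cases "x \<in> A")
        case True
        have "(1 - \<theta>) * (k / 4) \<le> (1 - cond_prob_label \<theta> x j) * kink (vector [s, s] \<bullet> x + 1) (u \<bullet> x)"
          using A_prop[OF True] weight_bounds(1)[of x j] weight_nonneg[of x j] k0 by (intro mult_mono) auto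
        then show ?thesis using True by simp
      next
        case False
        then show ?thesis using kink_nonneg weight_nonneg by simp
      qed
    qed
    finally show "c * (norm u)\<^sup>2
      \<le> (\<integral>x. (1 - cond_prob_label \<theta> x j) * kink (vector [s, s] \<bullet> x + 1) (u \<bullet> x) \<partial>input_law \<gamma>)" .
  qed
qed

end

section \<open>The minimizer of the hinge risk\<close>

definition corner :: "4 \<Rightarrow> real^2" where
  "corner j = (if j = 1 then vector [1, 1] else if j = 2 then vector [1, - 1]
    else if j = 3 then vector [- 1, 1] else vector [- 1, - 1])"

lemma abs_corner: "\<bar>corner j $ i\<bar> = 1"
  using exhaust_2[of i] by (auto simp: corner_def)

lemma norm_flip_corner: "norm (flip (corner j) x) = norm x"
  using abs_corner by (simp add: norm_vec_def abs_mult)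

lemma flip_inner: "flip e x \<bullet> y = x \<bullet> flip e y"
  by (simp add: inner_2 algebra_simps)

context four_class
begin

lemma integral_flip:
  fixes f :: "real^2 \<Rightarrow> real"
  assumes "f \<in> borel_measurable borel" "\<And>i. \<bar>e $ i\<bar> = 1"
  shows "(\<integral>x. f (flip e x) \<partial>input_law \<gamma>) = (\<integral>x. f x \<partial>input_law \<gamma>)"
  using integral_distr[of "flip e" "input_law \<gamma>" borel f] assms distr_input_law_flip[OF assms(2)]
  by simp

lemma integral_swap:
  fixes f :: "real^2 \<Rightarrow> real"
  assumes "f \<in> borel_measurable borel"
  shows "(\<integral>x. f (swap x) \<partial>input_law \<gamma>) = (\<integral>x. f x \<partial>input_law \<gamma>)"
  using integral_distr[of swap "input_law \<gamma>" borel f] assms distr_input_law_swap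
  by simp

text \<open>
  The reflection carries \<open>S_region 1\<close> to \<open>S_region j\<close> only up to the axes, which are null sets.
\<close>

lemma hinge_risk_flip: "hinge_risk \<gamma> \<theta> j v = hinge_risk \<gamma> \<theta> 1 (flip (corner j) v)"
proof -
  let ?e = "corner j"
  have "hinge_risk \<gamma> \<theta> j v
      = (\<integral>x. (1 - cond_prob_label \<theta> (flip ?e x) j) * max (v \<bullet> flip ?e x + 1) 0 \<partial>input_law \<gamma>)"
    unfolding hinge_risk_def by (rule integral_flip[symmetric]) (auto simp: abs_corner)
  also have "\<dots> = (\<integral>x. (1 - cond_prob_label \<theta> x 1) * max (flip ?e v \<bullet> x + 1) 0 \<partial>input_law \<gamma>)"
  proof (rule integral_cong_AE)
    show "AE x in input_law \<gamma>. (1 - cond_prob_label \<theta> (flip ?e x) j) * max (v \<bullet> flip ?e x + 1) 0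
      = (1 - cond_prob_label \<theta> x 1) * max (flip ?e v \<bullet> x + 1) 0"
      using AE_input_law_off_axes[of 1] AE_input_law_off_axes[of 2]
    proof eventually_elim
      fix x :: "real^2" assume x: "x $ 1 \<noteq> 0" "x $ 2 \<noteq> 0"
      have "flip ?e x \<in> S_region j \<longleftrightarrow> x \<in> S_region 1"
        using x by (auto simp: S_region_def corner_def)
      then show "(1 - cond_prob_label \<theta> (flip ?e x) j) * max (v \<bullet> flip ?e x + 1) 0
        = (1 - cond_prob_label \<theta> x 1) * max (flip ?e v \<bullet> x + 1) 0"
        by (simp add: cond_prob_label_def flip_inner)
    qed
  qed measurable
  finally show ?thesis by (simp add: hinge_risk_def)
qed

lemma hinge_risk_swap: "hinge_risk \<gamma> \<theta> 1 (swap v) = hinge_risk \<gamma> \<theta> 1 v"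
proof -
  have "hinge_risk \<gamma> \<theta> 1 (swap v)
      = (\<integral>x. (1 - cond_prob_label \<theta> (swap x) 1) * max (swap v \<bullet> swap x + 1) 0 \<partial>input_law \<gamma>)"
    unfolding hinge_risk_def by (rule integral_swap[symmetric]) auto
  also have "\<dots> = hinge_risk \<gamma> \<theta> 1 v"
  proof -
    have "cond_prob_label \<theta> (swap x) 1 = cond_prob_label \<theta> x 1" for x
      by (auto simp: cond_prob_label_def S_region_def)
    moreover have "swap v \<bullet> swap x = v \<bullet> x" for x by (simp add: inner_2)
    ultimately show ?thesis by (simp add: hinge_risk_def)
  qed
  finally show ?thesis .
qed

lemma hinge_risk_convex: "convex_on UNIV (hinge_risk \<gamma> \<theta> j)"
proof (rule convex_onI)
  fix t :: real and v v' :: "real^2" assume t: "0 < t" "t < 1"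
  have "hinge_risk \<gamma> \<theta> j ((1 - t) *\<^sub>R v + t *\<^sub>R v') \<le>
      (\<integral>x. (1 - t) * ((1 - cond_prob_label \<theta> x j) * max (v \<bullet> x + 1) 0)
        + t * ((1 - cond_prob_label \<theta> x j) * max (v' \<bullet> x + 1) 0) \<partial>input_law \<gamma>)"
    unfolding hinge_risk_def
  proof (rule integral_mono[OF hinge_integrable])
    show "integrable (input_law \<gamma>) (\<lambda>x. (1 - t) * ((1 - cond_prob_label \<theta> x j) * max (v \<bullet> x + 1) 0)
        + t * ((1 - cond_prob_label \<theta> x j) * max (v' \<bullet> x + 1) 0))"
      using hinge_integrable by simp
    show "(1 - cond_prob_label \<theta> x j) * max (((1 - t) *\<^sub>R v + t *\<^sub>R v') \<bullet> x + 1) 0 \<le>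
      (1 - t) * ((1 - cond_prob_label \<theta> x j) * max (v \<bullet> x + 1) 0)
        + t * ((1 - cond_prob_label \<theta> x j) * max (v' \<bullet> x + 1) 0)" for x
    proof -
      have "((1 - t) *\<^sub>R v + t *\<^sub>R v') \<bullet> x + 1 = (1 - t) * (v \<bullet> x + 1) + t * (v' \<bullet> x + 1)"
        by (simp add: inner_add_left algebra_simps)
      also have "\<dots> \<le> (1 - t) * max (v \<bullet> x + 1) 0 + t * max (v' \<bullet> x + 1) 0"
        using t by (intro add_mono mult_left_mono) auto
      finally have "max (((1 - t) *\<^sub>R v + t *\<^sub>R v') \<bullet> x + 1) 0
          \<le> (1 - t) * max (v \<bullet> x + 1) 0 + t * max (v' \<bullet> x + 1) 0"
        using t by simp
      from mult_left_mono[OF this weight_nonneg[of x j]] show ?thesis by (simp add: algebra_simps)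
    qed
  qed
  also have "\<dots> = (1 - t) * hinge_risk \<gamma> \<theta> j v + t * hinge_risk \<gamma> \<theta> j v'"
    unfolding hinge_risk_def using hinge_integrable by simp
  finally show "hinge_risk \<gamma> \<theta> j ((1 - t) *\<^sub>R v + t *\<^sub>R v')
    \<le> (1 - t) * hinge_risk \<gamma> \<theta> j v + t * hinge_risk \<gamma> \<theta> j v'" .
qed simp

lemma hinge_risk_lipschitz:
  "\<bar>hinge_risk \<gamma> \<theta> j v - hinge_risk \<gamma> \<theta> j v'\<bar> \<le> 2 * norm (v - v')"
proof -
  have "\<bar>hinge_risk \<gamma> \<theta> j v - hinge_risk \<gamma> \<theta> j v'\<bar> =
      \<bar>\<integral>x. (1 - cond_prob_label \<theta> x j) * (max (v \<bullet> x + 1) 0 - max (v' \<bullet> x + 1) 0) \<partial>input_law \<gamma>\<bar>"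
    unfolding hinge_risk_def using hinge_integrable
    by (simp add: right_diff_distrib)
  also have "\<dots> \<le> (\<integral>x. 2 * norm (v - v') \<partial>input_law \<gamma>)"
  proof (rule order_trans[OF integral_abs_bound], rule integral_mono_AE)
    have "\<bar>max (v \<bullet> x + 1) 0 - max (v' \<bullet> x + 1) 0\<bar> \<le> 2 * norm (v - v')" if "x \<in> square" for x
      using inner_square[OF that, of "v - v'"] by (auto simp: inner_diff_left)
    note * = this
    have "integrable (input_law \<gamma>) (\<lambda>x. (1 - cond_prob_label \<theta> x j) * (max (v \<bullet> x + 1) 0 - max (v' \<bullet> x + 1) 0))"
      by (rule integrable_weighted[OF _ *]) auto
    then show "integrable (input_law \<gamma>) (\<lambda>x. \<bar>(1 - cond_prob_label \<theta> x j) * (max (v \<bullet> x + 1) 0 - max (v' \<bullet> x + 1) 0)\<bar>)"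
      by (rule integrable_abs)
    show "AE x in input_law \<gamma>. \<bar>(1 - cond_prob_label \<theta> x j) * (max (v \<bullet> x + 1) 0 - max (v' \<bullet> x + 1) 0)\<bar> \<le> 2 * norm (v - v')"
      using AE_input_law_square by eventually_elim (meson * order_trans weighted_abs_le)
  qed simp
  also have "\<dots> = 2 * norm (v - v')" using PX.prob_space by simp
  finally show ?thesis .
qed

lemma coordinate_integrable: "integrable (input_law \<gamma>) (\<lambda>x. x $ i)"
  by (rule integrable_input_law[of _ 1]) (auto simp: square_def)

lemma integral_coordinate: "(\<integral>x. x $ i \<partial>input_law \<gamma>) = 0"
  using integral_flip[of "\<lambda>x. x $ i" "corner 4"] abs_corner[of 4]
  by (cases "i = 1") (use exhaust_2[of i] in \<open>auto simp: corner_def\<close>)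

lemma corner_mass: "0 < (\<integral>x. indicator (S_region 1) x * (x $ 1 + x $ 2) \<partial>input_law \<gamma>)"
proof -
  define A :: "(real^2) set" where "A = {x. x $ 1 \<in> {1/2..1} \<and> x $ 2 \<in> {1/2..1}}"
  have A[measurable]: "A \<in> sets borel" and eA: "emeasure lborel A = ennreal (1/4)"
    unfolding A_def using emeasure_rectangle[of "1/2" 1 "1/2" 1] by (auto simp: cbox_2[symmetric])
  have "0 < kappa \<gamma> * (1/2) powr \<gamma> * (1/4)" using kappa_pos by simp
  also have "\<dots> \<le> measure (input_law \<gamma>) A"
    by (rule measure_input_law_ge[OF A eA]) (auto simp: A_def square_def forall_2)
  also have "\<dots> = (\<integral>x. indicator A x \<partial>input_law \<gamma>)" by simp
  also have "\<dots> \<le> (\<integral>x. indicator (S_region 1) x * (x $ 1 + x $ 2) \<partial>input_law \<gamma>)"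
  proof (rule integral_mono)
    show "integrable (input_law \<gamma>) (\<lambda>x. indicator A x :: real)"
      by (rule integrable_input_law[of _ 1]) (auto simp: indicator_def)
    show "integrable (input_law \<gamma>) (\<lambda>x. indicator (S_region 1) x * (x $ 1 + x $ 2) :: real)"
      by (rule integrable_input_law[of _ 2]) (auto simp: indicator_def square_def forall_2)
    show "indicator A x \<le> (indicator (S_region 1) x * (x $ 1 + x $ 2) :: real)" for x
      by (auto simp: indicator_def A_def S_region_def)
  qed
  finally show ?thesis .
qed

text \<open>
  The input has mean zero, so only the correction of the weight on the first quadrant contributes, and this
  has the sign of \<open>1 - 4 \<theta>\<close>.
\<close>

lemma diagonal_slope_neg:
  "(\<integral>x. (1 - cond_prob_label \<theta> x 1) * (x $ 1 + x $ 2) \<partial>input_law \<gamma>) < 0"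
proof -
  have int: "integrable (input_law \<gamma>) (\<lambda>x. indicator (S_region 1) x * (x $ 1 + x $ 2) :: real)"
    by (rule integrable_input_law[of _ 2]) (auto simp: indicator_def square_def forall_2)
  have "(\<integral>x. (1 - cond_prob_label \<theta> x 1) * (x $ 1 + x $ 2) \<partial>input_law \<gamma>)
    = (\<integral>x. (2 + \<theta>) / 3 * x $ 1 + (2 + \<theta>) / 3 * x $ 2
        - (4 * \<theta> - 1) / 3 * (indicator (S_region 1) x * (x $ 1 + x $ 2)) \<partial>input_law \<gamma>)"
    by (intro Bochner_Integration.integral_cong) (auto simp: cond_prob_label_def indicator_def field_simps)
  also have "\<dots> = - ((4 * \<theta> - 1) / 3 * (\<integral>x. indicator (S_region 1) x * (x $ 1 + x $ 2) \<partial>input_law \<gamma>))"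
    using int coordinate_integrable integral_coordinate by simp
  also have "\<dots> < 0" using mult_pos_pos[OF _ corner_mass, of "(4 * \<theta> - 1) / 3"] theta by simp
  finally show ?thesis .
qed

lemma hinge_risk_ge_affine:
  "(\<integral>x. (1 - cond_prob_label \<theta> x 1) \<partial>input_law \<gamma>)
    + s * (\<integral>x. (1 - cond_prob_label \<theta> x 1) * (x $ 1 + x $ 2) \<partial>input_law \<gamma>)
    \<le> hinge_risk \<gamma> \<theta> 1 (vector [s, s])" (is ?le)
  and hinge_risk_eq_affine: "\<bar>s\<bar> \<le> 1/2 \<Longrightarrow>
    hinge_risk \<gamma> \<theta> 1 (vector [s, s]) = (\<integral>x. (1 - cond_prob_label \<theta> x 1) \<partial>input_law \<gamma>)
    + s * (\<integral>x. (1 - cond_prob_label \<theta> x 1) * (x $ 1 + x $ 2) \<partial>input_law \<gamma>)" (is "_ \<Longrightarrow> ?eq")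
proof -
  have i1: "integrable (input_law \<gamma>) (\<lambda>x. 1 - cond_prob_label \<theta> x 1)"
    using integrable_weighted[of "\<lambda>_. 1" 1 1] by simp
  have i2: "integrable (input_law \<gamma>) (\<lambda>x. (1 - cond_prob_label \<theta> x 1) * (x $ 1 + x $ 2))"
    by (rule integrable_weighted[of _ 2]) (auto simp: square_def forall_2)
  have eq: "(\<integral>x. (1 - cond_prob_label \<theta> x 1) \<partial>input_law \<gamma>)
    + s * (\<integral>x. (1 - cond_prob_label \<theta> x 1) * (x $ 1 + x $ 2) \<partial>input_law \<gamma>)
    = (\<integral>x. (1 - cond_prob_label \<theta> x 1) * (vector [s, s] \<bullet> x + 1) \<partial>input_law \<gamma>)"
    (is "?A = ?B")
  proof -
    have "?A = (\<integral>x. (1 - cond_prob_label \<theta> x 1) + s * ((1 - cond_prob_label \<theta> x 1) * (x $ 1 + x $ 2)) \<partial>input_law \<gamma>)"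
      using i1 i2 by (subst Bochner_Integration.integral_add) auto
    also have "\<dots> = ?B"
      by (intro Bochner_Integration.integral_cong) (auto simp: inner_2 algebra_simps)
    finally show ?thesis .
  qed
  have i3: "integrable (input_law \<gamma>) (\<lambda>x. (1 - cond_prob_label \<theta> x 1) * (vector [s, s] \<bullet> x + 1))"
    by (rule integrable_weighted[of _ "2 * norm (vector [s, s] :: real^2) + 1"])
      (use inner_square in \<open>auto intro: order_trans[OF abs_triangle_ineq]\<close>)
  show ?le
    unfolding eq hinge_risk_def
    by (intro integral_mono i3 hinge_integrable mult_left_mono weight_nonneg) auto
  assume s: "\<bar>s\<bar> \<le> 1/2"
  show ?eq
    unfolding eq hinge_risk_def
  proof (rule integral_cong_AE)
    show "AE x in input_law \<gamma>. (1 - cond_prob_label \<theta> x 1) * max (vector [s, s] \<bullet> x + 1) 0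
      = (1 - cond_prob_label \<theta> x 1) * (vector [s, s] \<bullet> x + 1)"
      using AE_input_law_square
    proof eventually_elim
      fix x :: "real^2" assume x: "x \<in> square"
      have "\<bar>s * (x $ 1 + x $ 2)\<bar> \<le> (1/2) * 2"
        unfolding abs_mult using x s by (intro mult_mono) (auto simp: square_def forall_2)
      then have "0 \<le> vector [s, s] \<bullet> x + 1" by (simp add: inner_2 algebra_simps abs_le_iff)
      then show "(1 - cond_prob_label \<theta> x 1) * max (vector [s, s] \<bullet> x + 1) 0
        = (1 - cond_prob_label \<theta> x 1) * (vector [s, s] \<bullet> x + 1)" by simp
    qed
  qed measurable
qed

text \<open>
  The risk need not be differentiated: its increments are the slope plus a remainder which is quadratically
  small, so a nonzero slope would make the risk decrease in some direction.
\<close>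

lemma slope_at_minimizer:
  assumes "0 < s" and min: "\<And>v. hinge_risk \<gamma> \<theta> 1 (vector [s, s]) \<le> hinge_risk \<gamma> \<theta> 1 v"
  shows "(\<integral>x. (1 - cond_prob_label \<theta> x 1) * (if 0 \<le> vector [s, s] \<bullet> x + 1 then u \<bullet> x else 0) \<partial>input_law \<gamma>) = 0"
proof -
  define slope where "slope u = (\<integral>x. (1 - cond_prob_label \<theta> x 1)
      * (if 0 \<le> vector [s, s] \<bullet> x + 1 then u \<bullet> x else 0) \<partial>input_law \<gamma>)" for u :: "real^2"
  have scale: "slope (t *\<^sub>R u) = t * slope u" for t u
  proof -
    have "slope (t *\<^sub>R u) = (\<integral>x. t * ((1 - cond_prob_label \<theta> x 1)
        * (if 0 \<le> vector [s, s] \<bullet> x + 1 then u \<bullet> x else 0)) \<partial>input_law \<gamma>)"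
      unfolding slope_def by (intro Bochner_Integration.integral_cong) auto
    then show ?thesis by (simp add: slope_def)
  qed
  have ge: "0 \<le> slope u" for u
  proof (rule ccontr)
    assume neg: "\<not> 0 \<le> slope u"
    define q where "q = 16 * kappa \<gamma> / s * (norm u)\<^sup>2"
    have q: "0 \<le> q" using kappa_pos assms(1) by (simp add: q_def)
    \<comment> \<open>Any step \<open>t\<close> with \<open>q * t < - slope u\<close> makes the risk decrease.\<close>
    define t where "t = - slope u / (q + 1)"
    have t: "0 < t" unfolding t_def using neg q by (intro divide_pos_pos) auto
    have "0 \<le> slope (t *\<^sub>R u) + 16 * kappa \<gamma> / s * (norm (t *\<^sub>R u))\<^sup>2"
      using hinge_risk_expand[of 1 "vector [s, s]" "t *\<^sub>R u"] min[of "vector [s, s] + t *\<^sub>R u"]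
        kink_integral_upper[OF assms(1), of 1 "t *\<^sub>R u"] by (simp add: slope_def)
    also have "\<dots> = t * (slope u + q * t)"
      by (simp add: scale q_def power2_eq_square algebra_simps)
    finally have "0 \<le> slope u + q * t" using t by (simp add: zero_le_mult_iff)
    moreover have "slope u + q * t = slope u / (q + 1)" using q by (simp add: t_def field_simps)
    moreover have "slope u / (q + 1) < 0" using neg q by (intro divide_neg_pos) auto
    ultimately show False by simp
  qed
  have "slope u = 0" using ge[of u] ge[of "- u"] scale[of "- 1" u] by simp
  then show ?thesis by (simp add: slope_def)
qed

text \<open>
  On the diagonal the risk is coercive on the positive side and at least its value at 0 on the negative side,
  so a minimizer \<open>s \<ge> 0\<close> exists; averaging with the exchanged point extends minimality to the plane. If
  \<open>s \<le> 1/2\<close>, then \<open>1/2\<close> would be a minimizer as well, as the risk is affine and decreasing up to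
  there. But the slope at \<open>1/2\<close> is still that of the affine part and does not vanish.
\<close>

lemma hinge_risk_minimizer:
  obtains s where "1/2 < s" "\<And>v. hinge_risk \<gamma> \<theta> 1 (vector [s, s]) \<le> hinge_risk \<gamma> \<theta> 1 v"
proof -
  define G where "G s = hinge_risk \<gamma> \<theta> 1 (vector [s, s])" for s
  define I where "I = (\<integral>x. (1 - cond_prob_label \<theta> x 1) \<partial>input_law \<gamma>)"
  define D where "D = (\<integral>x. (1 - cond_prob_label \<theta> x 1) * (x $ 1 + x $ 2) \<partial>input_law \<gamma>)"
  define m where "m = (\<integral>x. indicator (S_region 1) x * (x $ 1 + x $ 2) \<partial>input_law \<gamma>)"
  have D: "D < 0" using diagonal_slope_neg by (simp add: D_def)
  have m: "0 < m" using corner_mass by (simp add: m_def)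
  have aff: "I + s * D \<le> G s" for s using hinge_risk_ge_affine by (simp add: G_def I_def D_def)
  have eq: "G s = I + s * D" if "\<bar>s\<bar> \<le> 1/2" for s
    using hinge_risk_eq_affine[OF that] by (simp add: G_def I_def D_def)
  have coercive: "(1 - \<theta>) * m * s \<le> G s" if s: "0 \<le> s" for s
  proof -
    have "(1 - \<theta>) * m * s = (\<integral>x. (1 - \<theta>) * s * (indicator (S_region 1) x * (x $ 1 + x $ 2)) \<partial>input_law \<gamma>)"
      by (simp add: m_def)
    also have "\<dots> \<le> G s"
      unfolding G_def hinge_risk_def
    proof (rule integral_mono[OF _ hinge_integrable])
      show "integrable (input_law \<gamma>) (\<lambda>x. (1 - \<theta>) * s * (indicator (S_region 1) x * (x $ 1 + x $ 2)))"
        by (intro integrable_mult_right integrable_input_law[of _ 2]) (auto simp: indicator_def square_def forall_2)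
      show "(1 - \<theta>) * s * (indicator (S_region 1) x * (x $ 1 + x $ 2))
          \<le> (1 - cond_prob_label \<theta> x 1) * max (vector [s, s] \<bullet> x + 1) 0" for x
      proof -
        have "(1 - \<theta>) * (s * (indicator (S_region 1) x * (x $ 1 + x $ 2)))
          \<le> (1 - cond_prob_label \<theta> x 1) * max (vector [s, s] \<bullet> x + 1) 0"
          using weight_bounds[of x 1] theta s weight_nonneg[of x 1]
          by (intro mult_mono) (auto simp: inner_2 indicator_def S_region_def algebra_simps max_def)
        then show ?thesis by (simp add: mult.assoc)
      qed
    qed
    finally show ?thesis .
  qed
  have cont: "continuous_on S G" for S
  proof (rule continuous_onI)
    fix s e :: real assume "0 < e"
    show "\<exists>d>0. \<forall>s'\<in>S. dist s' s < d \<longrightarrow> dist (G s') (G s) \<le> e"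
    proof (intro exI conjI ballI impI)
      show "0 < e / 4" using \<open>0 < e\<close> by simp
      fix s' assume d: "dist s' s < e / 4"
      have "norm (vector [s', s'] - vector [s, s] :: real^2) \<le> 2 * dist s' s"
        using norm_le_2[of "vector [s', s'] - vector [s, s]"] by (simp add: dist_real_def)
      then show "dist (G s') (G s) \<le> e"
        using hinge_risk_lipschitz[of 1 "vector [s', s']" "vector [s, s]"] d
        by (simp add: G_def dist_real_def)
    qed
  qed
  define z where "z = (1 - \<theta>) * m"
  have z: "0 < z" using theta m by (simp add: z_def)
  define S where "S = \<bar>I\<bar> / z + 1"
  have S: "0 < S" using z by (simp add: S_def add_nonneg_pos)
  obtain s where s: "s \<in> {0..S}" "\<And>y. y \<in> {0..S} \<Longrightarrow> G s \<le> G y"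
    using continuous_attains_inf[of "{0..S}" G] cont S by auto
  have G0: "G 0 = I" using eq[of 0] by simp
  have minG: "G s \<le> G y" for y
  proof -
    have "G s \<le> G 0" using s(2) S by simp
    consider "y < 0" | "y \<in> {0..S}" | "S < y" by fastforce
    then show ?thesis
    proof cases
      case 1
      then have "0 \<le> y * D" using D by (simp add: mult_nonpos_nonpos)
      then show ?thesis using aff[of y] \<open>G s \<le> G 0\<close> G0 by simp
    next
      case 2 then show ?thesis by (rule s(2))
    next
      case 3
      have "\<bar>I\<bar> \<le> z * S" using z by (simp add: S_def field_simps)
      also have "\<dots> \<le> z * y" using 3 z by (intro mult_left_mono) auto
      finally show ?thesis using coercive[of y] z_def 3 S \<open>G s \<le> G 0\<close> G0 by simp
    qed
  qed
  have min: "G s' \<le> hinge_risk \<gamma> \<theta> 1 v" if s': "\<And>y. G s' \<le> G y" for s' v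
  proof -
    have sym: "(1 - 1/2) *\<^sub>R v + (1/2) *\<^sub>R swap v = vector [(v $ 1 + v $ 2) / 2, (v $ 1 + v $ 2) / 2]"
      by (simp add: vec_eq_iff forall_2 field_simps)
    have "G s' \<le> hinge_risk \<gamma> \<theta> 1 ((1 - 1/2) *\<^sub>R v + (1/2) *\<^sub>R swap v)"
      unfolding sym using s' by (simp add: G_def)
    also have "\<dots> \<le> hinge_risk \<gamma> \<theta> 1 v" 
      using convex_onD[OF hinge_risk_convex, of "1/2" v "swap v" 1] hinge_risk_swap by simp
    finally show ?thesis .
  qed
  have "1/2 < s"
  proof (rule ccontr)
    assume "\<not> 1/2 < s"
    then have "G (1/2) \<le> G s" using eq[of s] eq[of "1/2"] s(1) D by (simp add: mult_right_mono_neg)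
    then have half: "G (1/2) \<le> G y" for y using minG[of y] by linarith
    have "(\<integral>x. (1 - cond_prob_label \<theta> x 1) * (if 0 \<le> vector [1/2, 1/2] \<bullet> x + 1 then vector [1, 1] \<bullet> x else 0) \<partial>input_law \<gamma>) = 0"
      by (rule slope_at_minimizer) (use min[OF half] in \<open>auto simp: G_def\<close>)
    also have "(\<integral>x. (1 - cond_prob_label \<theta> x 1) * (if 0 \<le> vector [1/2, 1/2] \<bullet> x + 1 then vector [1, 1] \<bullet> x else 0) \<partial>input_law \<gamma>) = D"
      unfolding D_def
    proof (rule integral_cong_AE)
      show "AE x in input_law \<gamma>. (1 - cond_prob_label \<theta> x 1) * (if 0 \<le> vector [1/2, 1/2] \<bullet> x + 1 then vector [1, 1] \<bullet> x else 0)
        = (1 - cond_prob_label \<theta> x 1) * (x $ 1 + x $ 2)"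
        using AE_input_law_square
        by eventually_elim (auto simp: inner_2 square_def forall_2)
    qed measurable
    finally show False using D by simp
  qed
  then show thesis using that[of s] min[OF minG] by (simp add: G_def)
qed

lemma quadratic_growth:
  obtains s c C r0 :: real where "1/2 < s" "0 < c" "0 < r0"
    "\<And>j u. u \<noteq> 0 \<Longrightarrow> 0 < hinge_risk \<gamma> \<theta> j (s *\<^sub>R corner j + u) - hinge_risk \<gamma> \<theta> j (s *\<^sub>R corner j)"
    "\<And>j u. hinge_risk \<gamma> \<theta> j (s *\<^sub>R corner j + u) - hinge_risk \<gamma> \<theta> j (s *\<^sub>R corner j) \<le> C * (norm u)\<^sup>2"
    "\<And>j u. norm u \<le> r0 \<Longrightarrow> c * (norm u)\<^sup>2
        \<le> hinge_risk \<gamma> \<theta> j (s *\<^sub>R corner j + u) - hinge_risk \<gamma> \<theta> j (s *\<^sub>R corner j)"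
proof -
  obtain s where s: "1/2 < s" "\<And>v. hinge_risk \<gamma> \<theta> 1 (vector [s, s]) \<le> hinge_risk \<gamma> \<theta> 1 v"
    using hinge_risk_minimizer by blast
  obtain c r0 where c: "0 < c" "0 < r0"
    "\<And>u. norm u \<le> r0 \<Longrightarrow> c * (norm u)\<^sup>2
      \<le> (\<integral>x. (1 - cond_prob_label \<theta> x 1) * kink (vector [s, s] \<bullet> x + 1) (u \<bullet> x) \<partial>input_law \<gamma>)"
    by (rule kink_integral_lower[OF s(1), of 1]) blast
  have fl: "flip (corner j) (s *\<^sub>R corner j + u) = vector [s, s] + flip (corner j) u"
    "flip (corner j) (s *\<^sub>R corner j) = vector [s, s]" for j u
    by (auto simp: vec_eq_iff forall_2 corner_def algebra_simps)
  have eq: "hinge_risk \<gamma> \<theta> j (s *\<^sub>R corner j + u) - hinge_risk \<gamma> \<theta> j (s *\<^sub>R corner j)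
    = (\<integral>x. (1 - cond_prob_label \<theta> x 1) * kink (vector [s, s] \<bullet> x + 1) (flip (corner j) u \<bullet> x) \<partial>input_law \<gamma>)" for j u
    using hinge_risk_expand[of 1 "vector [s, s]" "flip (corner j) u"] s
      slope_at_minimizer[of s "flip (corner j) u"] hinge_risk_flip[of j] fl by simp
  have low: "c * (norm u)\<^sup>2 \<le> hinge_risk \<gamma> \<theta> j (s *\<^sub>R corner j + u) - hinge_risk \<gamma> \<theta> j (s *\<^sub>R corner j)"
    if "norm u \<le> r0" for j u
    unfolding eq using c(3)[of "flip (corner j) u"] that by (simp add: norm_flip_corner)
  show thesis
  proof (rule that[of s c r0 "16 * kappa \<gamma> / s"])
    show "0 < hinge_risk \<gamma> \<theta> j (s *\<^sub>R corner j + u) - hinge_risk \<gamma> \<theta> j (s *\<^sub>R corner j)"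
      if u: "u \<noteq> 0" for j u
    proof -
      \<comment> \<open>Growth within radius \<open>r0\<close> and convexity along the segment give strict growth everywhere.\<close>
      define t where "t = min 1 (r0 / norm u)"
      have t: "0 < t" "t \<le> 1" using c u by (auto simp: t_def)
      have "t * norm u \<le> r0 / norm u * norm u" unfolding t_def by (intro mult_right_mono) auto
      then have "norm (t *\<^sub>R u) \<le> r0" using t u by simp
      from low[OF this, of j] have "hinge_risk \<gamma> \<theta> j (s *\<^sub>R corner j) + c * (norm (t *\<^sub>R u))\<^sup>2
        \<le> hinge_risk \<gamma> \<theta> j ((1 - t) *\<^sub>R (s *\<^sub>R corner j) + t *\<^sub>R (s *\<^sub>R corner j + u))"
        by (simp add: algebra_simps)
      also have "\<dots> \<le> (1 - t) * hinge_risk \<gamma> \<theta> j (s *\<^sub>R corner j) + t * hinge_risk \<gamma> \<theta> j (s *\<^sub>R corner j + u)"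
        by (rule convex_onD[OF hinge_risk_convex]) (use t in auto)
      finally have "c * (norm (t *\<^sub>R u))\<^sup>2
        \<le> t * (hinge_risk \<gamma> \<theta> j (s *\<^sub>R corner j + u) - hinge_risk \<gamma> \<theta> j (s *\<^sub>R corner j))"
        by (simp add: algebra_simps)
      moreover have "0 < c * (norm (t *\<^sub>R u))\<^sup>2" using c t u by simp
      ultimately show ?thesis using t by (smt (verit) zero_less_mult_pos)
    qed
    show "hinge_risk \<gamma> \<theta> j (s *\<^sub>R corner j + u) - hinge_risk \<gamma> \<theta> j (s *\<^sub>R corner j) \<le> 16 * kappa \<gamma> / s * (norm u)\<^sup>2" for j u
      unfolding eq using kink_integral_upper[of s 1 "flip (corner j) u"] s by (simp add: norm_flip_corner)
    show "c * (norm u)\<^sup>2 \<le> hinge_risk \<gamma> \<theta> j (s *\<^sub>R corner j + u) - hinge_risk \<gamma> \<theta> j (s *\<^sub>R corner j)"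
      if "norm u \<le> r0" for j u by (rule low[OF that])
  qed (use s c in auto)
qed

end

section \<open>Labels, decisions and the Bayes risk\<close>

text \<open>
  The loss on \<^const>\<open>weights\<close>, extended to all coefficient matrices. The extension is convex and its risk
  decouples over the rows, so the constraint can be ignored in the analysis of the minimizer.
\<close>

definition label_hinge :: "real^2^4 \<Rightarrow> (real^2) \<times> 4 \<Rightarrow> real" where
  "label_hinge w z = (\<Sum>j\<in>UNIV. if j = snd z then 0 else max (w $ j \<bullet> fst z + 1) 0)"

definition decision :: "real^4 \<Rightarrow> 4" where
  "decision v = (ARG_MAX (\<lambda>j. v $ j) j. True)"

text \<open>
  The scores add up to zero, hence the margins for the label \<open>y\<close> add up to \<open>4 * v $ y\<close> and the mean that
  appears in \<^const>\<open>h_loss\<close> cancels the score of \<open>y\<close>.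
\<close>

lemma V_loss_lin:
  assumes "w \<in> weights"
  shows "V_loss (lin w) z = label_hinge w z"
proof -
  obtain x y where z: "z = (x, y)" by (cases z)
  define v where "v = lin w x"
  define js where "js = filter (\<lambda>j. j \<noteq> y) [1, 2, 3, 4 :: 4]"
  have zero: "v $ 4 = - (v $ 1 + v $ 2 + v $ 3)"
    using assms by (simp add: v_def lin_def weights_def inner_add_left inner_diff_left)
  have total: "sum_list (margins v y) = 4 * v $ y"
    using exhaust_4[of y] by (elim disjE) (simp_all add: margins_def zero)
  have "h_loss (margins v y) = (\<Sum>t\<leftarrow>margins v y. max (v $ y - t + 1) 0)"
    by (simp add: h_loss_def total)
  also have "\<dots> = (\<Sum>j\<leftarrow>js. max (v $ j + 1) 0)"
    by (simp add: margins_def js_def o_def)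
  also have "\<dots> = (\<Sum>j\<in>UNIV. if j = y then 0 else max (v $ j + 1) 0)"
    using exhaust_4[of y] by (elim disjE) (simp_all add: js_def sum_4)
  also have "\<dots> = label_hinge w z"
    by (simp add: label_hinge_def z v_def lin_def cong: if_cong)
  finally show ?thesis by (simp add: V_loss_def z v_def)
qed

lemma penalty_eq_norm: "penalty w = (norm w)\<^sup>2"
  by (simp only: penalty_def power2_norm_eq_inner inner_vec_def) (simp add: power2_eq_square)

lemma norm_sq_rows: "(norm (w :: real^2^4))\<^sup>2 = (\<Sum>j\<in>UNIV. (norm (w $ j))\<^sup>2)"
  by (simp only: power2_norm_eq_inner) (simp add: inner_vec_def)

lemma norm_row_le: "norm ((w :: real^2^4) $ j) \<le> norm w"
  by (rule Finite_Cartesian_Product.norm_nth_le)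

lemma label_hinge_convex: "convex_on UNIV (\<lambda>w. label_hinge w z)"
proof (rule convex_onI)
  fix t :: real and v w :: "real^2^4" assume t: "0 < t" "t < 1"
  have "max (((1 - t) *\<^sub>R v + t *\<^sub>R w) $ j \<bullet> fst z + 1) 0
      \<le> (1 - t) * max (v $ j \<bullet> fst z + 1) 0 + t * max (w $ j \<bullet> fst z + 1) 0" for j
  proof -
    have "((1 - t) *\<^sub>R v + t *\<^sub>R w) $ j \<bullet> fst z + 1 = (1 - t) * (v $ j \<bullet> fst z + 1) + t * (w $ j \<bullet> fst z + 1)"
      by (simp add: inner_add_left algebra_simps)
    also have "\<dots> \<le> (1 - t) * max (v $ j \<bullet> fst z + 1) 0 + t * max (w $ j \<bullet> fst z + 1) 0"
      using t by (intro add_mono mult_left_mono) auto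
    finally show ?thesis using t by simp
  qed
  then show "label_hinge ((1 - t) *\<^sub>R v + t *\<^sub>R w) z \<le> (1 - t) * label_hinge v z + t * label_hinge w z"
    unfolding label_hinge_def sum_distrib_left sum.distrib[symmetric]
    by (intro sum_mono) auto
qed simp

lemma label_hinge_lipschitz:
  assumes "fst z \<in> square"
  shows "\<bar>label_hinge v z - label_hinge w z\<bar> \<le> 8 * norm (v - w)"
proof -
  have "\<bar>label_hinge v z - label_hinge w z\<bar> \<le> (\<Sum>j\<in>(UNIV::4 set). 2 * norm (v - w))"
    unfolding label_hinge_def sum_subtractf[symmetric]
  proof (rule order_trans[OF sum_abs], rule sum_mono)
    fix j :: 4
    have "\<bar>(v - w) $ j \<bullet> fst z\<bar> \<le> 2 * norm (v - w)"
      using inner_square[OF assms, of "(v - w) $ j"] norm_row_le[of "v - w" j] by linarith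
    then show "\<bar>(if j = snd z then 0 else max (v $ j \<bullet> fst z + 1) 0)
      - (if j = snd z then 0 else max (w $ j \<bullet> fst z + 1) 0)\<bar> \<le> 2 * norm (v - w)"
      by (auto simp: inner_diff_left)
  qed
  then show ?thesis by simp
qed

lemma measurable_labelled:
  assumes [measurable]: "\<And>y. (\<lambda>x. f (x, y)) \<in> measurable M K"
  shows "f \<in> measurable (M \<Otimes>\<^sub>M count_space (UNIV :: 'b::countable set)) K"
  by (rule measurable_compose_countable'[where f="\<lambda>a b. f (fst b, a)" and g=snd and I=UNIV, simplified]) simp_all

lemma label_hinge_measurable_input: "(\<lambda>x. label_hinge w (x, y)) \<in> borel_measurable borel"
  unfolding label_hinge_def fst_conv snd_conv
proof (rule borel_measurable_sum)
  fix j
  show "(\<lambda>x. if j = y then 0 else max (w $ j \<bullet> x + 1) 0) \<in> borel_measurable borel"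
  proof (cases "j = y")
    case False
    have "(\<lambda>x. max (w $ j \<bullet> x + 1) 0) \<in> borel_measurable borel" by measurable
    then show ?thesis using False by (simp only: if_False)
  qed (simp only: simp_thms if_True borel_measurable_const)
qed

lemma label_hinge_measurable [measurable]:
  "label_hinge w \<in> borel_measurable (borel \<Otimes>\<^sub>M count_space UNIV)"
  by (rule measurable_labelled[OF label_hinge_measurable_input])

text \<open>
  The choice among several maximizing labels is unspecified but depends only on the set of maximizing
  labels, of which there are finitely many possible values.
\<close>

lemma decision_measurable:
  assumes f[measurable]: "f \<in> borel_measurable borel"
  shows "{x::real^2. decision (f x) = y} \<in> sets borel"
proof -
  define T where "T v = {j::4. \<forall>k. v $ k \<le> v $ j}" for v :: "real^4"
  have dec: "decision v = (SOME j. j \<in> T v)" for v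
    by (simp add: decision_def arg_max_def is_arg_max_def T_def not_less)
  have "{x. decision (f x) = y} = (\<Union>B\<in>{B. (SOME j. j \<in> B) = y}. {x. T (f x) = B})"
    by (auto simp: dec)
  also have "\<dots> \<in> sets borel"
  proof (rule sets.finite_UN)
    show "finite {B :: 4 set. (SOME j. j \<in> B) = y}" by (rule finite_subset[OF subset_UNIV]) simp
    fix B :: "4 set"
    have [measurable]: "(\<lambda>x. f x $ j) \<in> borel_measurable borel" for j
      by (rule measurable_compose[OF f vec_nth_measurable])
    define Q where "Q j = {x. \<forall>k. f x $ k \<le> f x $ j}" for j
    have "Q j = (\<Inter>k. {x. f x $ k \<le> f x $ j})" for j by (auto simp: Q_def)
    then have Q: "Q j \<in> sets borel" for j by (simp add: sets.finite_INT)
    define R where "R j = (if j \<in> B then Q j else - Q j)" for j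
    have R: "R j \<in> sets borel" for j using Q[of j] by (simp add: R_def borel_comp)
    have R_iff: "x \<in> R j \<longleftrightarrow> (j \<in> B \<longleftrightarrow> x \<in> Q j)" for x j by (simp add: R_def)
    have "{x. T (f x) = B} = (\<Inter>j. R j)"
      unfolding set_eq_iff by (simp add: R_iff T_def Q_def) blast
    also have "\<dots> \<in> sets borel" using R by (intro sets.finite_INT) auto
    finally show "{x. T (f x) = B} \<in> sets borel" .
  qed
  finally show ?thesis .
qed

lemma decision_unique:
  assumes "\<And>k. k \<noteq> j \<Longrightarrow> v $ k < v $ j"
  shows "decision v = j"
proof -
  have "\<not> v $ j < v $ k" for k using assms[of k] by (cases "k = j") auto
  then have "is_arg_max (\<lambda>j. v $ j) (\<lambda>_. True) j" by (simp add: is_arg_max_def)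
  then have "is_arg_max (\<lambda>j. v $ j) (\<lambda>_. True) (decision v)"
    unfolding decision_def arg_max_def by (rule someI)
  then have "\<not> v $ decision v < v $ j" by (simp add: is_arg_max_def)
  then show ?thesis using assms[of "decision v"] by blast
qed

text \<open>
  Replacing the corner of the own quadrant by another one flips the sign of at least one coordinate.
\<close>

lemma corner_inner:
  assumes "x \<in> S_region j"
  shows "corner j \<bullet> x = \<bar>x $ 1\<bar> + \<bar>x $ 2\<bar>"
    and "k \<noteq> j \<Longrightarrow> corner k \<bullet> x \<le> \<bar>x $ 1\<bar> + \<bar>x $ 2\<bar> - 2 * min \<bar>x $ 1\<bar> \<bar>x $ 2\<bar>"
proof -
  show "corner j \<bullet> x = \<bar>x $ 1\<bar> + \<bar>x $ 2\<bar>"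
    using exhaust_4[of j] by (elim disjE) (use assms in \<open>simp_all add: S_region_def corner_def inner_2\<close>)
  assume "k \<noteq> j"
  with exhaust_4[of j] exhaust_4[of k]
  show "corner k \<bullet> x \<le> \<bar>x $ 1\<bar> + \<bar>x $ 2\<bar> - 2 * min \<bar>x $ 1\<bar> \<bar>x $ 2\<bar>"
    by (elim disjE) (use assms in \<open>simp_all add: S_region_def corner_def inner_2 min_def\<close>)
qed

lemma S_region_exists: "\<exists>j. x \<in> S_region j"
proof -
  have "x \<in> S_region 1 \<or> x \<in> S_region 2 \<or> x \<in> S_region 3 \<or> x \<in> S_region 4"
    by (auto simp: S_region_def)
  then show ?thesis by blast
qed

text \<open>
  The gap between the best two scores of \<open>s *\<^sub>R corner j\<close> at \<open>x\<close> is at least \<open>2 s \<ge> 1\<close> times the distance to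
  the axes, while a perturbation of size \<open>d\<close> moves the difference of two scores by at most \<open>4 d\<close>.
\<close>

lemma decision_near_pattern:
  assumes x: "x \<in> square" and j: "x \<in> S_region j" and s: "1/2 < s"
    and w: "norm (w - (\<chi> j. s *\<^sub>R corner j)) \<le> d" and far: "4 * d < min \<bar>x $ 1\<bar> \<bar>x $ 2\<bar>"
  shows "decision (lin w x) = j"
proof (rule decision_unique)
  fix k assume k: "k \<noteq> j"
  have near: "\<bar>w $ i \<bullet> x - s * (corner i \<bullet> x)\<bar> \<le> 2 * d" for i
    using inner_square[OF x, of "(w - (\<chi> j. s *\<^sub>R corner j)) $ i"] norm_row_le[of "w - (\<chi> j. s *\<^sub>R corner j)" i] w
    by (simp add: inner_diff_left)
  have m: "0 < min \<bar>x $ 1\<bar> \<bar>x $ 2\<bar>" using far w norm_ge_zero[of "w - (\<chi> j. s *\<^sub>R corner j)"] by linarith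
  have "s * (corner k \<bullet> x) \<le> s * (corner j \<bullet> x - 2 * min \<bar>x $ 1\<bar> \<bar>x $ 2\<bar>)"
    using corner_inner[OF j] k s by (intro mult_left_mono) auto
  also have "\<dots> = s * (corner j \<bullet> x) - (2 * s) * min \<bar>x $ 1\<bar> \<bar>x $ 2\<bar>" by (simp add: algebra_simps)
  also have "\<dots> < s * (corner j \<bullet> x) - 1 * (4 * d)"
  proof -
    have "1 * min \<bar>x $ 1\<bar> \<bar>x $ 2\<bar> \<le> (2 * s) * min \<bar>x $ 1\<bar> \<bar>x $ 2\<bar>"
      using m s by (intro mult_right_mono) auto
    then show ?thesis using far by linarith
  qed
  finally show "lin w x $ k < lin w x $ j"
    using near[of k] near[of j] by (simp add: lin_def abs_le_iff)
qed

context four_class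
begin

lemma cond_prob_label_sum: "(\<Sum>y\<in>UNIV. cond_prob_label \<theta> x y) = 1"
proof -
  consider "x $ 1 \<ge> 0" "x $ 2 \<ge> 0" | "x $ 1 \<ge> 0" "x $ 2 < 0" | "x $ 1 < 0" "x $ 2 \<ge> 0" | "x $ 1 < 0" "x $ 2 < 0"
    by linarith
  then show ?thesis
    by cases (auto simp: sum_4 cond_prob_label_def S_region_def field_simps)
qed

lemma integral_law:
  fixes f :: "(real^2) \<times> 4 \<Rightarrow> real" and K :: real
  assumes f[measurable]: "\<And>y. (\<lambda>x. f (x, y)) \<in> borel_measurable borel"
    and K: "\<And>x y. x \<in> square \<Longrightarrow> \<bar>f (x, y)\<bar> \<le> K"
  shows "integral\<^sup>L (law \<gamma> \<theta>) f = (\<integral>x. (\<Sum>y\<in>UNIV. cond_prob_label \<theta> x y * f (x, y)) \<partial>input_law \<gamma>)"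
    and "integrable (law \<gamma> \<theta>) f"
proof -
  interpret pair_sigma_finite "lborel :: (real^2) measure" "count_space (UNIV :: 4 set)"
    by (intro pair_sigma_finite.intro lborel.sigma_finite_measure_axioms sigma_finite_measure_count_space_finite) simp
  define g where "g = (\<lambda>(x, y). q_density \<gamma> x * cond_prob_label \<theta> x y)"
  have g0: "0 \<le> g z" for z
    using q_density_nonneg theta by (auto simp: g_def cond_prob_label_def split: prod.split)
  have g[measurable]: "g \<in> borel_measurable (lborel \<Otimes>\<^sub>M count_space UNIV)"
    by (rule measurable_labelled) (simp add: g_def)
  have fm[measurable]: "f \<in> borel_measurable (lborel \<Otimes>\<^sub>M count_space UNIV)"
    by (rule measurable_labelled) simp
  have law: "law \<gamma> \<theta> = density (lborel \<Otimes>\<^sub>M count_space UNIV) (\<lambda>z. ennreal (g z))"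
    by (simp add: law_def g_def split_def)
  have bnd: "\<bar>g (x, y) * f (x, y)\<bar> \<le> q_density \<gamma> x * K" for x y
  proof (cases "x \<in> square")
    case True
    have "cond_prob_label \<theta> x y \<le> 1" "0 \<le> cond_prob_label \<theta> x y" using theta by (auto simp: cond_prob_label_def)
    then have "cond_prob_label \<theta> x y * \<bar>f (x, y)\<bar> \<le> 1 * K"
      using K[OF True, of y] by (intro mult_mono) auto
    then have "q_density \<gamma> x * (cond_prob_label \<theta> x y * \<bar>f (x, y)\<bar>) \<le> q_density \<gamma> x * (1 * K)"
      by (rule mult_left_mono) (rule q_density_nonneg)
    then show ?thesis using q_density_nonneg[of x] \<open>0 \<le> cond_prob_label \<theta> x y\<close>
      by (simp add: g_def abs_mult mult.assoc)
  next
    case False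
    then show ?thesis by (simp add: g_def q_density_def shape_def)
  qed
  have q_int: "integrable lborel (\<lambda>x. q_density \<gamma> x * K)"
    using shape_integrable by (simp add: q_density_def)
  have int: "integrable (lborel \<Otimes>\<^sub>M count_space UNIV) (\<lambda>z. g z * f z)"
  proof (rule Fubini_integrable)
    show "integrable lborel (\<lambda>x. \<integral>y. norm (g (x, y) * f (x, y)) \<partial>count_space UNIV)"
    proof -
      have "integrable lborel (\<lambda>x. \<Sum>y\<in>UNIV. norm (g (x, y) * f (x, y)))"
      proof (intro Bochner_Integration.integrable_sum)
        fix y :: 4
        show "integrable lborel (\<lambda>x. norm (g (x, y) * f (x, y)))"
        proof (rule Bochner_Integration.integrable_bound[OF q_int])
          show "AE x in lborel. norm (norm (g (x, y) * f (x, y))) \<le> norm (q_density \<gamma> x * K)"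
            using order_trans[OF bnd abs_ge_self] by (intro AE_I2) simp
        qed (simp add: g_def)
      qed
      then show ?thesis by (simp add: lebesgue_integral_count_space_finite)
    qed
    show "AE x in lborel. integrable (count_space UNIV) (\<lambda>y. g (x, y) * f (x, y))"
      by (simp add: integrable_count_space)
  qed measurable
  show "integrable (law \<gamma> \<theta>) f"
    unfolding law using int g0 by (subst integrable_density) auto
  have "integral\<^sup>L (law \<gamma> \<theta>) f = (\<integral>z. g z * f z \<partial>(lborel \<Otimes>\<^sub>M count_space UNIV))"
    unfolding law using g0 by (subst integral_density) auto
  also have "\<dots> = (\<integral>x. (\<integral>y. g (x, y) * f (x, y) \<partial>count_space UNIV) \<partial>lborel)"
    by (rule integral_fst'[OF int, symmetric])
  also have "\<dots> = (\<integral>x. q_density \<gamma> x * (\<Sum>y\<in>UNIV. cond_prob_label \<theta> x y * f (x, y)) \<partial>lborel)"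
    by (simp add: lebesgue_integral_count_space_finite g_def sum_distrib_left mult.assoc)
  also have "\<dots> = (\<integral>x. (\<Sum>y\<in>UNIV. cond_prob_label \<theta> x y * f (x, y)) \<partial>input_law \<gamma>)"
    unfolding input_law_def using q_density_nonneg by (subst integral_density) auto
  finally show "integral\<^sup>L (law \<gamma> \<theta>) f = (\<integral>x. (\<Sum>y\<in>UNIV. cond_prob_label \<theta> x y * f (x, y)) \<partial>input_law \<gamma>)" .
qed

lemma AE_law_square: "AE z in law \<gamma> \<theta>. fst z \<in> square"
proof -
  have [measurable]: "(\<lambda>(x, y). ennreal (q_density \<gamma> x * cond_prob_label \<theta> x y)) \<in> borel_measurable (lborel \<Otimes>\<^sub>M count_space UNIV)"
    by (rule measurable_labelled) simp
  show ?thesis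
    unfolding law_def
  proof (subst AE_density)
    have "q_density \<gamma> x = 0" if "x \<notin> square" for x using that by (simp add: q_density_def shape_def)
    then show "AE z in lborel \<Otimes>\<^sub>M count_space UNIV.
      0 < (case z of (x, y) \<Rightarrow> ennreal (q_density \<gamma> x * cond_prob_label \<theta> x y)) \<longrightarrow> fst z \<in> square"
      by (intro AE_I2) force
  qed measurable
qed

lemma label_hinge_risk:
  "integral\<^sup>L (law \<gamma> \<theta>) (label_hinge w) = (\<Sum>j\<in>UNIV. hinge_risk \<gamma> \<theta> j (w $ j))"
  and label_hinge_integrable: "integrable (law \<gamma> \<theta>) (label_hinge w)"
proof -
  have m: "(\<lambda>x. label_hinge w (x, y)) \<in> borel_measurable borel" for y
    by (rule label_hinge_measurable_input)
  have b: "\<bar>label_hinge w (x, y)\<bar> \<le> (\<Sum>j\<in>(UNIV::4 set). 2 * norm (w $ j) + 1)" if "x \<in> square" for x y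
    unfolding label_hinge_def
  proof (rule order_trans[OF sum_abs], rule sum_mono)
    fix j
    show "\<bar>if j = snd (x, y) then 0 else max (w $ j \<bullet> fst (x, y) + 1) 0\<bar> \<le> 2 * norm (w $ j) + 1"
      using hinge_bound[OF that, of "w $ j"] by auto
  qed
  have "integral\<^sup>L (law \<gamma> \<theta>) (label_hinge w)
      = (\<integral>x. (\<Sum>y\<in>UNIV. cond_prob_label \<theta> x y * label_hinge w (x, y)) \<partial>input_law \<gamma>)"
    by (rule integral_law(1)[OF m b])
  also have "\<dots> = (\<integral>x. (\<Sum>j\<in>UNIV. (1 - cond_prob_label \<theta> x j) * max (w $ j \<bullet> x + 1) 0) \<partial>input_law \<gamma>)"
  proof (rule Bochner_Integration.integral_cong[OF refl])
    fix x :: "real^2"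
    define m where "m j = max (w $ j \<bullet> x + 1) 0" for j
    have "label_hinge w (x, y) = (\<Sum>j\<in>UNIV. m j - (if j = y then m j else 0))" for y
      unfolding label_hinge_def by (intro sum.cong) (auto simp: m_def)
    then have "label_hinge w (x, y) = (\<Sum>j\<in>UNIV. m j) - m y" for y
      by (simp add: sum_subtractf)
    then have "(\<Sum>y\<in>UNIV. cond_prob_label \<theta> x y * label_hinge w (x, y))
      = (\<Sum>y\<in>UNIV. cond_prob_label \<theta> x y) * (\<Sum>j\<in>UNIV. m j) - (\<Sum>y\<in>UNIV. cond_prob_label \<theta> x y * m y)"
      by (simp add: right_diff_distrib sum_subtractf sum_distrib_right)
    also have "\<dots> = (\<Sum>j\<in>UNIV. (1 - cond_prob_label \<theta> x j) * m j)"
      by (simp add: cond_prob_label_sum left_diff_distrib sum_subtractf)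
    finally show "(\<Sum>y\<in>UNIV. cond_prob_label \<theta> x y * label_hinge w (x, y))
      = (\<Sum>j\<in>UNIV. (1 - cond_prob_label \<theta> x j) * max (w $ j \<bullet> x + 1) 0)"
      by (simp add: m_def)
  qed
  also have "\<dots> = (\<Sum>j\<in>UNIV. hinge_risk \<gamma> \<theta> j (w $ j))"
    unfolding hinge_risk_def using hinge_integrable by (subst Bochner_Integration.integral_sum) auto
  finally show "integral\<^sup>L (law \<gamma> \<theta>) (label_hinge w) = (\<Sum>j\<in>UNIV. hinge_risk \<gamma> \<theta> j (w $ j))" .
  show "integrable (law \<gamma> \<theta>) (label_hinge w)" by (rule integral_law(2)[OF m b])
qed

lemma EL_eq:
  assumes [measurable]: "f \<in> borel_measurable borel"
  shows "EL \<gamma> \<theta> f = (\<integral>x. 1 - cond_prob_label \<theta> x (decision (f x)) \<partial>input_law \<gamma>)"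
    and "integrable (input_law \<gamma>) (\<lambda>x. 1 - cond_prob_label \<theta> x (decision (f x)))"
proof -
  have L: "L_loss f (x, y) = (if decision (f x) = y then 0 else 1)" for x y
    by (auto simp: L_loss_def decision_def)
  have dec[measurable]: "Measurable.pred borel (\<lambda>x. decision (f x) = y)" for y
    using decision_measurable[OF assms, of y] by (simp add: pred_def)
  have m: "(\<lambda>x. L_loss f (x, y)) \<in> borel_measurable borel" for y
    unfolding L by measurable
  have s: "(\<Sum>y\<in>UNIV. cond_prob_label \<theta> x y * L_loss f (x, y)) = 1 - cond_prob_label \<theta> x (decision (f x))" for x
  proof -
    have "(\<Sum>y\<in>UNIV. cond_prob_label \<theta> x y * L_loss f (x, y))
      = (\<Sum>y\<in>UNIV. cond_prob_label \<theta> x y - (if decision (f x) = y then cond_prob_label \<theta> x y else 0))"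
      by (intro sum.cong) (auto simp: L)
    then show ?thesis by (simp add: sum_subtractf cond_prob_label_sum)
  qed
  show "EL \<gamma> \<theta> f = (\<integral>x. 1 - cond_prob_label \<theta> x (decision (f x)) \<partial>input_law \<gamma>)"
    unfolding EL_def by (subst integral_law(1)[of "L_loss f" 1]) (use m in \<open>auto simp: L s[unfolded L]\<close>)
  have "(\<lambda>x. (\<Sum>y\<in>UNIV. cond_prob_label \<theta> x y * L_loss f (x, y))) \<in> borel_measurable borel"
    using m by measurable
  then show "integrable (input_law \<gamma>) (\<lambda>x. 1 - cond_prob_label \<theta> x (decision (f x)))"
    unfolding s by (rule integrable_input_law[of _ 1]) (use weight_bounds weight_nonneg in auto)
qed

lemma EL_ge: "f \<in> borel_measurable borel \<Longrightarrow> 1 - \<theta> \<le> EL \<gamma> \<theta> f"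
  using PX.integral_ge_const[OF EL_eq(2)] weight_bounds(1) by (simp add: EL_eq(1))

lemma lin_measurable [measurable]: "lin w \<in> borel_measurable borel"
proof -
  have "linear (lin w)"
    by (rule linearI) (auto simp: lin_def vec_eq_iff inner_add_right)
  then show ?thesis by (rule borel_measurable_linear)
qed

text \<open>
  Within \<open>4 d\<close> of the axes the excess of the conditional error is at most 1; elsewhere the decision is the quadrant and the
  conditional error is minimal.
\<close>

lemma EL_near_pattern:
  assumes s: "1/2 < s" and d: "norm (w - (\<chi> j. s *\<^sub>R corner j)) = d"
  shows "EL \<gamma> \<theta> (lin w) - (1 - \<theta>) \<le> min 1 (32 * kappa \<gamma> * 4 powr \<gamma> * d powr (\<gamma> + 1))"
proof -
  have d0: "0 \<le> d" using d by auto
  define A where "A i = {x::real^2. x \<in> square \<and> \<bar>x $ i\<bar> \<le> 4 * d}" for i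
  have A[measurable]: "A i \<in> sets borel" for i unfolding A_def by measurable
  have PA: "measure (input_law \<gamma>) (A i) \<le> kappa \<gamma> * (4 * d) powr \<gamma> * (16 * d)" for i
  proof -
    define B where "B = (if i = 1 then {x::real^2. x $ 1 \<in> {- 4 * d..4 * d} \<and> x $ 2 \<in> {-1..1}}
      else {x. x $ 1 \<in> {-1..1} \<and> x $ 2 \<in> {- 4 * d..4 * d}})"
    have B: "B \<in> sets borel" by (simp add: B_def cbox_2[symmetric] split del: if_split) auto
    show ?thesis
    proof (rule measure_input_law_le[OF A B])
      show "emeasure lborel B = ennreal (16 * d)"
        unfolding B_def using emeasure_rectangle[of "- 4 * d" "4 * d" "-1" 1]
          emeasure_rectangle[of "-1" 1 "- 4 * d" "4 * d"] d0 by simp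
      show "A i \<inter> square \<subseteq> B"
        using exhaust_2[of i] by (auto simp: A_def B_def square_def forall_2 abs_le_iff)
      show "min \<bar>x $ 1\<bar> \<bar>x $ 2\<bar> \<le> 4 * d" if "x \<in> A i \<inter> square" for x
        using exhaust_2[of i] that by (auto simp: A_def)
    qed (use d0 in auto)
  qed
  have "EL \<gamma> \<theta> (lin w) \<le> (\<integral>x. (1 - \<theta>) + indicator (A 1 \<union> A 2) x \<partial>input_law \<gamma>)"
    unfolding EL_eq(1)[OF lin_measurable]
  proof (rule integral_mono_AE[OF EL_eq(2)[OF lin_measurable]])
    show "integrable (input_law \<gamma>) (\<lambda>x. (1 - \<theta>) + indicator (A 1 \<union> A 2) x)"
      by (rule integrable_input_law[of _ "\<bar>1 - \<theta>\<bar> + 1"]) (auto simp: indicator_def)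
    show "AE x in input_law \<gamma>. 1 - cond_prob_label \<theta> x (decision (lin w x)) \<le> (1 - \<theta>) + indicator (A 1 \<union> A 2) x"
      using AE_input_law_square
    proof eventually_elim
      fix x :: "real^2" assume x: "x \<in> square"
      show "1 - cond_prob_label \<theta> x (decision (lin w x)) \<le> (1 - \<theta>) + indicator (A 1 \<union> A 2) x"
      proof (cases "x \<in> A 1 \<union> A 2")
        case True
        have "0 \<le> cond_prob_label \<theta> x (decision (lin w x))" using theta by (auto simp: cond_prob_label_def)
        then show ?thesis using True theta by simp
      next
        case False
        then have far: "4 * d < min \<bar>x $ 1\<bar> \<bar>x $ 2\<bar>" using x by (auto simp: A_def)
        obtain j where j: "x \<in> S_region j" using S_region_exists by blast
        have "decision (lin w x) = j"
          by (rule decision_near_pattern[OF x j s _ far]) (simp add: d)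
        then show ?thesis using j by (simp add: cond_prob_label_def)
      qed
    qed
  qed
  also have "\<dots> = (1 - \<theta>) + measure (input_law \<gamma>) (A 1 \<union> A 2)"
  proof -
    have "integrable (input_law \<gamma>) (indicator (A 1 \<union> A 2) :: _ \<Rightarrow> real)"
      by (rule integrable_input_law[of _ 1]) (auto simp: indicator_def)
    then show ?thesis using PX.prob_space by (subst Bochner_Integration.integral_add) auto
  qed
  finally have 1: "EL \<gamma> \<theta> (lin w) - (1 - \<theta>) \<le> measure (input_law \<gamma>) (A 1 \<union> A 2)" by simp
  have "measure (input_law \<gamma>) (A 1 \<union> A 2) \<le> measure (input_law \<gamma>) (A 1) + measure (input_law \<gamma>) (A 2)"
    by (rule measure_Un_le) auto
  also have "\<dots> \<le> 2 * (kappa \<gamma> * (4 * d) powr \<gamma> * (16 * d))" using PA[of 1] PA[of 2] by simp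
  also have "\<dots> = 32 * kappa \<gamma> * 4 powr \<gamma> * d powr (\<gamma> + 1)"
    using d0 by (cases "d = 0") (auto simp: powr_mult powr_add)
  finally have 2: "measure (input_law \<gamma>) (A 1 \<union> A 2) \<le> 32 * kappa \<gamma> * 4 powr \<gamma> * d powr (\<gamma> + 1)" .
  have "measure (input_law \<gamma>) (A 1 \<union> A 2) \<le> 1" by (rule PX.prob_le_1)
  then show ?thesis using 1 2 by (intro min.boundedI) linarith+
qed

end

section \<open>Rates from Gaussian tails\<close>

lemma summable_powr_gaussian:
  fixes p a :: real
  assumes "0 < a"
  shows "summable (\<lambda>k. (real k + 1) powr p * exp (- a * (real k)\<^sup>2))"
proof (rule summable_comparison_test_bigo)
  show "summable (\<lambda>k. norm (1 / (real k)\<^sup>2))"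
    using inverse_power_summable[of 2, where 'a=real] by (simp add: inverse_eq_divide)
  show "(\<lambda>k. (real k + 1) powr p * exp (- a * (real k)\<^sup>2)) \<in> O(\<lambda>k. 1 / (real k)\<^sup>2)"
    using assms by real_asymp
qed

text \<open>
  For the expectation, the distances below \<open>r0\<close> are split into shells \<open>k \<le> D \<surd>n < k + 1\<close>. On such a
  shell \<open>e\<close> is at most \<open>B (k + 1)\<^sup>p n\<^bsup>-p/2\<^esup>\<close>, while its probability is at most \<open>K exp (- a k\<^sup>2)\<close>, so the sum over
  \<open>k\<close> converges uniformly in \<open>n\<close>. Beyond \<open>r0\<close> the bound \<open>e \<le> 1\<close> and the exponentially small
  probability suffice. The integral of a nonintegrable function and the measure of a nonmeasurable set
  are 0, so the conclusions hold for every \<open>e\<close> below the bound.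
\<close>

lemma (in prob_space) rate_from_tail:
  fixes D e :: "nat \<Rightarrow> 'a \<Rightarrow> real" and p B K a r0 :: real and n1 :: nat
  assumes "0 < p" "0 \<le> B" "0 \<le> K" "0 < a" "0 < r0" "1 \<le> n1"
    and D: "\<And>n. n1 \<le> n \<Longrightarrow> D n \<in> borel_measurable M"
    and D0: "\<And>n \<omega>. n1 \<le> n \<Longrightarrow> \<omega> \<in> space M \<Longrightarrow> 0 \<le> D n \<omega>"
    and e: "\<And>n \<omega>. n1 \<le> n \<Longrightarrow> \<omega> \<in> space M \<Longrightarrow> 0 \<le> e n \<omega> \<and> e n \<omega> \<le> min 1 (B * D n \<omega> powr p)"
    and tail: "\<And>n r. \<lbrakk>n1 \<le> n; 1 / sqrt (real n) \<le> r; r \<le> r0\<rbrakk>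
      \<Longrightarrow> prob {\<omega>\<in>space M. r \<le> D n \<omega>} \<le> K * exp (- a * real n * r\<^sup>2)"
  shows "O_p M e (\<lambda>n. real n powr (- p / 2))"
    and "(\<lambda>n. expectation (e n)) \<in> O(\<lambda>n. real n powr (- p / 2))"
proof -
  have scale: "(t / sqrt (real n)) powr p = t powr p * real n powr (- p / 2)" if "0 \<le> t" "0 < n" for t :: real and n :: nat
  proof -
    have "sqrt (real n) powr p = real n powr (1/2 * p)"
      unfolding powr_powr[symmetric] by (simp only: powr_half_sqrt of_nat_0_le_iff)
    moreover have "real n powr (- p / 2) = inverse (real n powr (1/2 * p))"
      unfolding powr_minus[symmetric] by simp
    ultimately show ?thesis
      unfolding powr_divide by (simp only: divide_inverse)
  qed
  show "O_p M e (\<lambda>n. real n powr (- p / 2))"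
    unfolding O_p_def
  proof (intro allI impI)
    fix \<epsilon> :: real assume eps: "0 < \<epsilon>"
    have "((\<lambda>t::real. K * exp (- a * t\<^sup>2)) \<longlongrightarrow> 0) at_top" using \<open>0 < a\<close> by real_asymp
    then have "\<forall>\<^sub>F t::real in at_top. K * exp (- a * t\<^sup>2) < \<epsilon>" using eps by (rule order_tendstoD)
    then obtain t where t: "1 \<le> t" "K * exp (- a * t\<^sup>2) < \<epsilon>"
      by (metis (no_types, lifting) eventually_at_top_linorder linorder_le_cases order_refl)
    show "\<exists>C>0. \<forall>\<^sub>F n in sequentially. prob {\<omega>\<in>space M. C * real n powr (- p / 2) < \<bar>e n \<omega>\<bar>} < \<epsilon>"
    proof (intro exI conjI)
      show "0 < B * t powr p + 1" using \<open>0 \<le> B\<close> by (simp add: add_nonneg_pos)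
      have "((\<lambda>n. t / sqrt (real n)) \<longlongrightarrow> 0) sequentially" by real_asymp
      then have "\<forall>\<^sub>F n in sequentially. t / sqrt (real n) < r0" using \<open>0 < r0\<close> by (rule order_tendstoD)
      then show "\<forall>\<^sub>F n in sequentially. prob {\<omega>\<in>space M. (B * t powr p + 1) * real n powr (- p / 2) < \<bar>e n \<omega>\<bar>} < \<epsilon>"
        using eventually_ge_at_top[of n1]
      proof eventually_elim
        fix n assume r: "t / sqrt (real n) < r0" and n: "n1 \<le> n"
        then have npos: "0 < n" using \<open>1 \<le> n1\<close> by simp
        note [measurable] = D[OF n]
        have "prob {\<omega>\<in>space M. (B * t powr p + 1) * real n powr (- p / 2) < \<bar>e n \<omega>\<bar>}
            \<le> prob {\<omega>\<in>space M. t / sqrt (real n) \<le> D n \<omega>}"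
        proof (rule finite_measure_mono)
          show "{\<omega>\<in>space M. (B * t powr p + 1) * real n powr (- p / 2) < \<bar>e n \<omega>\<bar>}
            \<subseteq> {\<omega>\<in>space M. t / sqrt (real n) \<le> D n \<omega>}"
          proof safe
            fix \<omega> assume w: "\<omega> \<in> space M" and gt: "(B * t powr p + 1) * real n powr (- p / 2) < \<bar>e n \<omega>\<bar>"
            show "t / sqrt (real n) \<le> D n \<omega>"
            proof (rule ccontr)
              assume "\<not> ?thesis"
              then have "D n \<omega> powr p \<le> (t / sqrt (real n)) powr p"
                using D0[OF n w] \<open>0 < p\<close> by (intro powr_mono2) auto
              then have "B * D n \<omega> powr p \<le> B * (t powr p * real n powr (- p / 2))"
                using scale[of t n] t npos \<open>0 \<le> B\<close> by (intro mult_left_mono) auto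
              then have "\<bar>e n \<omega>\<bar> \<le> B * t powr p * real n powr (- p / 2)"
                using e[OF n w] by simp
              moreover have "0 \<le> real n powr (- p / 2)" by simp
              ultimately show False using gt unfolding distrib_right mult_1 by linarith
            qed
          qed
        qed measurable
        also have "\<dots> \<le> K * exp (- a * real n * (t / sqrt (real n))\<^sup>2)"
          using n r t by (intro tail) (auto intro!: divide_right_mono)
        also have "- a * real n * (t / sqrt (real n))\<^sup>2 = - a * t\<^sup>2"
          using npos by (simp add: power_divide)
        finally show "prob {\<omega>\<in>space M. (B * t powr p + 1) * real n powr (- p / 2) < \<bar>e n \<omega>\<bar>} < \<epsilon>"
          using t by simp
      qed
    qed
  qed
  define S where "S = (\<Sum>k. (real k + 1) powr p * exp (- a * (real k)\<^sup>2))"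
  have bound: "expectation (e n) \<le> B * (1 + K * S) * real n powr (- p / 2) + K * exp (- a * r0\<^sup>2 * real n)"
    if n: "n1 \<le> n" and nr: "1 / sqrt (real n) \<le> r0" for n
  proof -
    have npos: "0 < n" using n \<open>1 \<le> n1\<close> by simp
    note [measurable] = D[OF n]
    define m where "m = nat \<lfloor>r0 * sqrt (real n)\<rfloor>"
    define E where "E k = {\<omega>\<in>space M. real k / sqrt (real n) \<le> D n \<omega>}" for k :: nat
    define F where "F = {\<omega>\<in>space M. r0 \<le> D n \<omega>}"
    have [measurable]: "E k \<in> events" "F \<in> events" for k unfolding E_def F_def by measurable
    define g where "g \<omega> = B * real n powr (- p / 2) * (1 + (\<Sum>k=1..m. (real k + 1) powr p * indicator (E k) \<omega>)) + indicator F \<omega>" for \<omega>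
    have q0: "0 \<le> B * real n powr (- p / 2)" using \<open>0 \<le> B\<close> by simp
    have le: "e n \<omega> \<le> g \<omega>" if w: "\<omega> \<in> space M" for \<omega>
    proof (cases "r0 \<le> D n \<omega>")
      case True
      have "0 \<le> B * real n powr (- p / 2) * (1 + (\<Sum>k=1..m. (real k + 1) powr p * indicator (E k) \<omega>))"
        by (intro mult_nonneg_nonneg[OF q0] add_nonneg_nonneg sum_nonneg) auto
      then show ?thesis using True w e[OF n w] by (simp add: g_def F_def)
    next
      case False
      define k where "k = nat \<lfloor>D n \<omega> * sqrt (real n)\<rfloor>"
      have y0: "0 \<le> D n \<omega> * sqrt (real n)" using D0[OF n w] by simp
      then have k: "real k \<le> D n \<omega> * sqrt (real n)" "D n \<omega> * sqrt (real n) \<le> real k + 1"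
        unfolding k_def by linarith+
      have sq: "0 < sqrt (real n)" using npos by simp
      have "D n \<omega> \<le> (real k + 1) / sqrt (real n)" using k(2) sq by (simp add: pos_le_divide_eq)
      then have "D n \<omega> powr p \<le> ((real k + 1) / sqrt (real n)) powr p"
        using D0[OF n w] \<open>0 < p\<close> by (intro powr_mono2) auto
      also have "\<dots> = (real k + 1) powr p * real n powr (- p / 2)"
        using scale[of "real k + 1" n] npos by simp
      finally have "e n \<omega> \<le> B * ((real k + 1) powr p * real n powr (- p / 2))"
        using e[OF n w] mult_left_mono[OF _ \<open>0 \<le> B\<close>] by (meson min.boundedE order_trans)
      also have "\<dots> = B * real n powr (- p / 2) * (real k + 1) powr p" by simp
      also have "(real k + 1) powr p \<le> 1 + (\<Sum>k=1..m. (real k + 1) powr p * indicator (E k) \<omega>)"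
      proof (cases "k = 0")
        case True then show ?thesis by (simp add: sum_nonneg)
      next
        case k1: False
        have "D n \<omega> * sqrt (real n) \<le> r0 * sqrt (real n)" using False sq by simp
        then have "k \<le> m" unfolding k_def m_def by (intro nat_mono floor_mono)
        have "real k / sqrt (real n) \<le> D n \<omega>" using k(1) sq by (simp add: pos_divide_le_eq)
        then have "(real k + 1) powr p = (real k + 1) powr p * indicator (E k) \<omega>"
          using w by (simp add: E_def)
        also have "\<dots> \<le> (\<Sum>k=1..m. (real k + 1) powr p * indicator (E k) \<omega>)"
          by (rule member_le_sum[of k "{1..m}" "\<lambda>k. (real k + 1) powr p * indicator (E k) \<omega>"])
            (use \<open>k \<le> m\<close> k1 in auto)
        finally show ?thesis by simp
      qed
      finally have "e n \<omega> \<le> B * real n powr (- p / 2) * (1 + (\<Sum>k=1..m. (real k + 1) powr p * indicator (E k) \<omega>))"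
        using q0 by (simp add: mult_left_mono)
      then show ?thesis unfolding g_def by (simp add: add_increasing2)
    qed
    have ind: "integrable M (indicator A :: 'a \<Rightarrow> real)" if "A \<in> events" for A
      using that by (simp add: integrable_indicator_iff less_top[symmetric])
    have ind_sum: "integrable M (\<lambda>\<omega>. \<Sum>k=1..m. (real k + 1) powr p * indicator (E k) \<omega> :: real)"
      by (intro Bochner_Integration.integrable_sum integrable_mult_right ind) simp
    have int: "integrable M g"
      unfolding g_def by (intro Bochner_Integration.integrable_add integrable_mult_right ind_sum ind) simp_all
    have Eg: "expectation g = B * real n powr (- p / 2) * (1 + (\<Sum>k=1..m. (real k + 1) powr p * prob (E k))) + prob F"
    proof -
      have "expectation (\<lambda>\<omega>. \<Sum>k=1..m. (real k + 1) powr p * indicator (E k) \<omega>) = (\<Sum>k=1..m. (real k + 1) powr p * prob (E k))"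
        by (subst Bochner_Integration.integral_sum) (auto intro!: integrable_mult_right ind)
      then show ?thesis
        unfolding g_def using ind_sum ind[of F] by (simp add: prob_space del: sum_mult_indicator)
    qed
    have "expectation (e n) \<le> expectation g"
    proof (cases "integrable M (e n)")
      case True then show ?thesis using le int by (intro integral_mono) auto
    next
      case False
      have "0 \<le> expectation g" unfolding Eg
        by (intro add_nonneg_nonneg mult_nonneg_nonneg[OF q0] sum_nonneg) auto
      then show ?thesis using False by (simp add: not_integrable_integral_eq)
    qed
    also have "\<dots> \<le> B * real n powr (- p / 2) * (1 + K * S) + K * exp (- a * r0\<^sup>2 * real n)"
      unfolding Eg
    proof (intro add_mono mult_left_mono q0 order_refl)
      have "(\<Sum>k=1..m. (real k + 1) powr p * prob (E k)) \<le> (\<Sum>k=1..m. K * ((real k + 1) powr p * exp (- a * (real k)\<^sup>2)))"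
      proof (rule sum_mono)
        fix k assume k: "k \<in> {1..m}"
        have "real k \<le> r0 * sqrt (real n)" using k unfolding m_def atLeastAtMost_iff by linarith
        then have "real k / sqrt (real n) \<le> r0" using npos by (simp add: pos_divide_le_eq)
        then have "prob (E k) \<le> K * exp (- a * real n * (real k / sqrt (real n))\<^sup>2)"
          unfolding E_def using n k by (intro tail) (auto intro!: divide_right_mono)
        also have "- a * real n * (real k / sqrt (real n))\<^sup>2 = - a * (real k)\<^sup>2"
          using npos by (simp add: power_divide)
        finally have "(real k + 1) powr p * prob (E k) \<le> (real k + 1) powr p * (K * exp (- a * (real k)\<^sup>2))"
          by (intro mult_left_mono) auto
        then show "(real k + 1) powr p * prob (E k) \<le> K * ((real k + 1) powr p * exp (- a * (real k)\<^sup>2))"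
          by (simp add: algebra_simps)
      qed
      also have "\<dots> = K * (\<Sum>k=1..m. (real k + 1) powr p * exp (- a * (real k)\<^sup>2))"
        by (simp add: sum_distrib_left)
      also have "\<dots> \<le> K * S"
        unfolding S_def using summable_powr_gaussian[OF \<open>0 < a\<close>] \<open>0 \<le> K\<close>
        by (intro mult_left_mono sum_le_suminf) auto
      finally show "(\<Sum>k=1..m. (real k + 1) powr p * prob (E k)) \<le> K * S" .
      have "prob F \<le> K * exp (- a * real n * r0\<^sup>2)"
        unfolding F_def using n nr by (intro tail) auto
      then show "prob F \<le> K * exp (- a * r0\<^sup>2 * real n)" by (simp add: mult_ac)
    qed
    finally show ?thesis by (simp add: mult_ac)
  qed
  have "((\<lambda>n. 1 / sqrt (real n)) \<longlongrightarrow> 0) sequentially" by real_asymp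
  then have ev: "\<forall>\<^sub>F n in sequentially. 1 / sqrt (real n) < r0" using \<open>0 < r0\<close> by (rule order_tendstoD)
  have "(\<lambda>n. expectation (e n)) \<in> O(\<lambda>n. B * (1 + K * S) * real n powr (- p / 2) + K * exp (- a * r0\<^sup>2 * real n))"
  proof (rule landau_o.big_mono)
    show "\<forall>\<^sub>F n in sequentially. norm (expectation (e n))
        \<le> norm (B * (1 + K * S) * real n powr (- p / 2) + K * exp (- a * r0\<^sup>2 * real n))"
      using ev eventually_ge_at_top[of n1]
    proof eventually_elim
      fix n assume n: "1 / sqrt (real n) < r0" "n1 \<le> n"
      have "0 \<le> expectation (e n)" using e[OF n(2)] by (intro Bochner_Integration.integral_nonneg) auto
      then show "norm (expectation (e n))
        \<le> norm (B * (1 + K * S) * real n powr (- p / 2) + K * exp (- a * r0\<^sup>2 * real n))"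
        using bound[of n] n by simp
    qed
  qed
  also have "(\<lambda>n. B * (1 + K * S) * real n powr (- p / 2) + K * exp (- a * r0\<^sup>2 * real n)) \<in> O(\<lambda>n. real n powr (- p / 2))"
  proof (rule sum_in_bigo)
    show "(\<lambda>n. B * (1 + K * S) * real n powr (- p / 2)) \<in> O(\<lambda>n. real n powr (- p / 2))" by simp
    define b where "b = a * r0\<^sup>2"
    have b: "0 < b" using \<open>0 < a\<close> \<open>0 < r0\<close> by (simp add: b_def)
    have "(\<lambda>n. exp (- b * real n)) \<in> O(\<lambda>n. real n powr (- p / 2))"
      using b \<open>0 < p\<close> by real_asymp
    then show "(\<lambda>n. K * exp (- a * r0\<^sup>2 * real n)) \<in> O(\<lambda>n. real n powr (- p / 2))"
      by (simp add: b_def)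
  qed
  finally show "(\<lambda>n. expectation (e n)) \<in> O(\<lambda>n. real n powr (- p / 2))" .
qed

section \<open>Rate of the excess risk\<close>

theorem mainTheorem3:
  fixes M :: "'a measure"
    and Z :: "nat \<Rightarrow> 'a \<Rightarrow> (real^2) \<times> 4"
    and w_hat :: "nat \<Rightarrow> 'a \<Rightarrow> real^2^4"
    and w_V :: "real^2^4"
    and f_bar :: "real^2 \<Rightarrow> real^4"
    and lam :: "nat \<Rightarrow> real"
    and \<gamma> \<theta> :: real
  assumes "\<gamma> \<ge> 0" and "1/4 < \<theta>" and "\<theta> < 1"
    and "prob_space M"
    and indep: "prob_space.indep_vars M (\<lambda>_. borel \<Otimes>\<^sub>M count_space UNIV) Z {1..}"
    and distributed: "\<And>i. i \<ge> 1 \<Longrightarrow> distr M (borel \<Otimes>\<^sub>M count_space UNIV) (Z i) = law \<gamma> \<theta>"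
    and lam_nonneg: "\<And>n. n \<ge> 1 \<Longrightarrow> lam n \<ge> 0"
    and lam_order: "lam \<in> \<Theta>(\<lambda>n. 1 / real n)"
    and w_hat_measurable: "\<And>n. n \<ge> 1 \<Longrightarrow> w_hat n \<in> borel_measurable M"
    and w_hat_min: "\<And>n \<omega>. n \<ge> 1 \<Longrightarrow> \<omega> \<in> space M \<Longrightarrow>
      is_arg_min (objective (\<lambda>i. Z i \<omega>) n (lam n)) (\<lambda>w. w \<in> weights) (w_hat n \<omega>)"
    and w_V_min: "is_arg_min (\<lambda>w. EV \<gamma> \<theta> (lin w)) (\<lambda>w. w \<in> weights) w_V"
    and f_bar: "bayes_rule \<gamma> \<theta> f_bar"
  shows "(\<forall>n\<ge>1. \<forall>\<omega>\<in>space M.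
            excess \<gamma> \<theta> (lin (w_hat n \<omega>)) f_bar = excess \<gamma> \<theta> (lin (w_hat n \<omega>)) (lin w_V) \<and>
            excess \<gamma> \<theta> (lin (w_hat n \<omega>)) (lin w_V) = \<bar>excess \<gamma> \<theta> (lin (w_hat n \<omega>)) (lin w_V)\<bar>)
       \<and> O_p M (\<lambda>n \<omega>. \<bar>excess \<gamma> \<theta> (lin (w_hat n \<omega>)) (lin w_V)\<bar>)
            (\<lambda>n. real n powr (- (\<gamma> + 1) / 2))
       \<and> (\<lambda>n. \<integral>\<omega>. \<bar>excess \<gamma> \<theta> (lin (w_hat n \<omega>)) (lin w_V)\<bar> \<partial>M)
            \<in> O(\<lambda>n. real n powr (- (\<gamma> + 1) / 2))"
proof -
  interpret prob_space M by fact
  interpret four_class \<gamma> \<theta> by unfold_locales fact+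
  obtain s c C r0 :: real where s: "1/2 < s" and "0 < c" "0 < r0"
    and strict: "\<And>j u. u \<noteq> 0 \<Longrightarrow>
      0 < hinge_risk \<gamma> \<theta> j (s *\<^sub>R corner j + u) - hinge_risk \<gamma> \<theta> j (s *\<^sub>R corner j)"
    and upper: "\<And>j u. hinge_risk \<gamma> \<theta> j (s *\<^sub>R corner j + u) - hinge_risk \<gamma> \<theta> j (s *\<^sub>R corner j)
      \<le> C * (norm u)\<^sup>2"
    and lower: "\<And>j u. norm u \<le> r0 \<Longrightarrow> c * (norm u)\<^sup>2
      \<le> hinge_risk \<gamma> \<theta> j (s *\<^sub>R corner j + u) - hinge_risk \<gamma> \<theta> j (s *\<^sub>R corner j)"
    by (rule quadratic_growth) blast
  define w0 :: "real^2^4" where "w0 = (\<chi> j. s *\<^sub>R corner j)"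
  have w0: "w0 \<in> weights"
    by (simp add: weights_def w0_def vec_eq_iff forall_2 corner_def)
  have row: "s *\<^sub>R corner j + (w - w0) $ j = w $ j" for w j by (simp add: w0_def)

  have EV: "EV \<gamma> \<theta> (lin w) = (\<Sum>j\<in>UNIV. hinge_risk \<gamma> \<theta> j (w $ j))" if "w \<in> weights" for w
    using V_loss_lin[OF that] by (simp add: EV_def label_hinge_risk)
  have w_V: "w_V \<in> weights" "EV \<gamma> \<theta> (lin w_V) \<le> EV \<gamma> \<theta> (lin w0)"
    using w_V_min w0 by (auto simp: is_arg_min_def not_less)
  have "w_V = w0"
  proof (rule ccontr)
    assume "w_V \<noteq> w0"
    then obtain j where j: "(w_V - w0) $ j \<noteq> 0" by (auto simp: vec_eq_iff)
    have le: "hinge_risk \<gamma> \<theta> i (w0 $ i) \<le> hinge_risk \<gamma> \<theta> i (w_V $ i)" for i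
      using strict[of "(w_V - w0) $ i" i] row[of i w_V] row[of i w0]
      by (cases "(w_V - w0) $ i = 0") (auto simp: w0_def)
    have "(\<Sum>i\<in>UNIV. hinge_risk \<gamma> \<theta> i (w0 $ i)) < (\<Sum>i\<in>UNIV. hinge_risk \<gamma> \<theta> i (w_V $ i))"
      using le strict[OF j, of j] row[of j w_V] by (intro sum_strict_mono_ex1) (auto simp: w0_def)
    then show False using w_V EV w0 by simp
  qed

  have EL_w0: "EL \<gamma> \<theta> (lin w0) = 1 - \<theta>"
    using EL_near_pattern[OF s, of w0 0] EL_ge[OF lin_measurable, of w0] by (simp add: w0_def)
  have EL_f_bar: "EL \<gamma> \<theta> f_bar = 1 - \<theta>"
  proof -
    have "f_bar \<in> borel_measurable borel" "\<not> EL \<gamma> \<theta> (lin w0) < EL \<gamma> \<theta> f_bar"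
      using f_bar lin_measurable[of w0] unfolding bayes_rule_def is_arg_min_def by blast+
    then show ?thesis using EL_ge[of f_bar] EL_w0 by simp
  qed
  have excess_w_V: "excess \<gamma> \<theta> (lin w) (lin w_V) = EL \<gamma> \<theta> (lin w) - (1 - \<theta>)" for w
    by (simp add: excess_def \<open>w_V = w0\<close> EL_w0)
  have excess_nonneg: "0 \<le> excess \<gamma> \<theta> (lin w) (lin w_V)" for w
    using EL_ge[OF lin_measurable, of w] by (simp add: excess_w_V)
  have excess_le: "excess \<gamma> \<theta> (lin w) (lin w_V)
      \<le> min 1 (32 * kappa \<gamma> * 4 powr \<gamma> * norm (w - w0) powr (\<gamma> + 1))" for w
    unfolding excess_w_V by (rule EL_near_pattern[OF s]) (simp add: w0_def)

  obtain \<Lambda> where "\<forall>\<^sub>F n in sequentially. norm (lam n) \<le> \<Lambda> * norm (1 / real n)"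
    using bigthetaD1[OF lam_order] by (auto elim: landau_o.bigE)
  then obtain n0 where n0: "\<And>n. n0 \<le> n \<Longrightarrow> norm (lam n) \<le> \<Lambda> * norm (1 / real n)"
    by (auto simp: eventually_at_top_linorder)
  obtain K a r1 n1 where tail: "0 \<le> K" "0 < a" "0 < r1" "1 \<le> n1"
    "\<And>n r A. \<lbrakk>n1 \<le> n; 1 / sqrt (real n) \<le> r; r \<le> r1; A \<subseteq> space M;
        \<And>\<omega>. \<omega> \<in> A \<Longrightarrow> \<exists>w. r \<le> norm (w - w0) \<and>
          (\<Sum>i=1..n. label_hinge w (Z i \<omega>)) / real n + lam n * (norm w)\<^sup>2
            \<le> (\<Sum>i=1..n. label_hinge w0 (Z i \<omega>)) / real n + lam n * (norm w0)\<^sup>2\<rbrakk>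
      \<Longrightarrow> prob A \<le> K * exp (- a * real n * r\<^sup>2)"
  proof (rule penalized_minimizer_tail[where N="borel \<Otimes>\<^sub>M count_space UNIV" and P="law \<gamma> \<theta>"
        and loss=label_hinge and L=8 and R=r0 and c=c and C=C and ?w0.0=w0 and lam=lam
        and \<Lambda>=\<Lambda> and ?n0.0="max 1 n0", OF indep distributed label_hinge_measurable label_hinge_convex])
    show "AE z in law \<gamma> \<theta>. \<bar>label_hinge w z - label_hinge w0 z\<bar> \<le> 8 * norm (w - w0)" for w
      using AE_law_square by eventually_elim (rule label_hinge_lipschitz)
    show "0 \<le> lam n \<and> lam n \<le> \<Lambda> / real n" if "max 1 n0 \<le> n" for n
      using lam_nonneg[of n] n0[of n] that by simp
    show "c * (norm (w - w0))\<^sup>2 \<le> (\<integral>z. label_hinge w z - label_hinge w0 z \<partial>law \<gamma> \<theta>) \<and>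
        (\<integral>z. label_hinge w z - label_hinge w0 z \<partial>law \<gamma> \<theta>) \<le> C * (norm (w - w0))\<^sup>2"
      if w: "norm (w - w0) \<le> r0" for w
    proof -
      have "(\<integral>z. label_hinge w z - label_hinge w0 z \<partial>law \<gamma> \<theta>)
        = (\<Sum>j\<in>UNIV. hinge_risk \<gamma> \<theta> j (s *\<^sub>R corner j + (w - w0) $ j) - hinge_risk \<gamma> \<theta> j (s *\<^sub>R corner j))"
        using label_hinge_integrable unfolding row
        by (simp add: label_hinge_risk sum_subtractf w0_def)
      moreover have "norm ((w - w0) $ j) \<le> r0" for j using norm_row_le[of "w - w0" j] w by linarith
      ultimately show ?thesis
        unfolding norm_sq_rows[of "w - w0"] sum_distrib_left
        using upper lower by (auto intro!: sum_mono)
    qed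
  qed (use \<open>0 < c\<close> \<open>0 < r0\<close> in auto)

  have hat_tail: "prob {\<omega>\<in>space M. r \<le> norm (w_hat n \<omega> - w0)} \<le> K * exp (- a * real n * r\<^sup>2)"
    if n: "n1 \<le> n" and r: "1 / sqrt (real n) \<le> r" "r \<le> r1" for n r
  proof (rule tail(5)[OF n r])
    fix \<omega> assume "\<omega> \<in> {\<omega>\<in>space M. r \<le> norm (w_hat n \<omega> - w0)}"
    then have \<omega>: "\<omega> \<in> space M" "r \<le> norm (w_hat n \<omega> - w0)" by auto
    have "1 \<le> n" using n tail(4) by simp
    from w_hat_min[OF this \<omega>(1)] w0 have "w_hat n \<omega> \<in> weights"
      "objective (\<lambda>i. Z i \<omega>) n (lam n) (w_hat n \<omega>) \<le> objective (\<lambda>i. Z i \<omega>) n (lam n) w0"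
      by (auto simp: is_arg_min_def not_less)
    then show "\<exists>w. r \<le> norm (w - w0) \<and>
          (\<Sum>i=1..n. label_hinge w (Z i \<omega>)) / real n + lam n * (norm w)\<^sup>2
            \<le> (\<Sum>i=1..n. label_hinge w0 (Z i \<omega>)) / real n + lam n * (norm w0)\<^sup>2"
      using \<omega>(2) w0 by (intro exI[of _ "w_hat n \<omega>"]) (simp add: objective_def V_loss_lin penalty_eq_norm)
  qed auto
  have hat_measurable: "(\<lambda>\<omega>. norm (w_hat n \<omega> - w0)) \<in> borel_measurable M" if "n1 \<le> n" for n
  proof -
    have [measurable]: "w_hat n \<in> borel_measurable M" using that tail(4) by (intro w_hat_measurable) simp
    show ?thesis by measurable
  qed
  have p: "0 < \<gamma> + 1" and B: "0 \<le> 32 * kappa \<gamma> * 4 powr \<gamma>" using gamma kappa_pos by simp_all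
  have excess_abs: "0 \<le> \<bar>excess \<gamma> \<theta> (lin w) (lin w_V)\<bar> \<and> \<bar>excess \<gamma> \<theta> (lin w) (lin w_V)\<bar>
      \<le> min 1 (32 * kappa \<gamma> * 4 powr \<gamma> * norm (w - w0) powr (\<gamma> + 1))" for w
    using excess_le[of w] excess_nonneg[of w] by simp
  note rates = rate_from_tail[OF p B tail(1-4) hat_measurable norm_ge_zero excess_abs hat_tail]
  show ?thesis
    using rates excess_nonneg by (auto simp: excess_def EL_f_bar \<open>w_V = w0\<close> EL_w0)
qed

end
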